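(* Let $Q,N\in\mathbb{N}$, let $(a_n)_{n\in\mathbb{Z}[i]}$ be any sequence of complex numbers, put $Z=\sum_{n\in\mathbb{Z}[i],\ \mathcal{N}(n)\le N}|a_n|^2$, let $\mathcal{S}\subseteq B(0,Q^{1/2})\cap(\mathbb{Z}[i]\setminus\{0\})$ and let $X\ge1$. Suppose that $$A_t(u,k,l)\le\Big(1+\frac{|\mathcal{S}_t|/\mathcal{N}(k)}{Q/|t|^2}\,u^2\Big)X$$ holds for all $t\in\mathbb{Z}[i]\setminus\{0\}$ with $|t|\le N^{1/4}$, all $k\in\mathbb{Z}[i]\setminus\{0\}$ with $|k|\le N^{1/4}/|t|$, all $l\in\mathbb{Z}[i]$ with $(k,l)=1$, and all real $u$ with $|k|\sqrt{Q}/(2N^{1/4})\le u\le \sqrt{Q}/|t|$. Then for every $\varepsilon>0$ there is a constant $c_2>0$ depending only on $\varepsilon$ such that $$\sum_{q\in\mathcal{S}}\ \sum_{\substack{a\bmod q\\ (a,q)=1}}\Big|\sum_{\substack{n\in\mathbb{Z}[i]\\ \mathcal{N}(n)\le N}} a_n\, e\Big(\Re\Big(\frac{na}{q}\Big)\Big)\Big|^2\le c_2\Big(N+QXN^{\varepsilon}\big(\sqrt{N}+|\mathcal{S}|\big)\Big)Z.$$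
   Context: $e(x)=e^{2\pi i x}$. $\mathbb{Z}[i]$ denotes the Gaussian integers and $\mathcal{N}(q)=\Re(q)^2+\Im(q)^2$. For $y\in\mathbb{C}$, $u\ge0$, $B(y,u)=\{w\in\mathbb{C}:|w-y|\le u\}$. "$a\bmod q$, $(a,q)=1$" means $a$ runs over a complete system of residues modulo $q$ in $\mathbb{Z}[i]$ coprime to $q$. For $t\in\mathbb{Z}[i]\setminus\{0\}$, $\mathcal{S}_t=\{q\in\mathbb{Z}[i]: tq\in\mathcal{S}\}$, and for $u\ge0$, $k\in\mathbb{Z}[i]\setminus\{0\}$, $l\in\mathbb{Z}[i]$, $$A_t(u,k,l)=\sup_{y\in\mathbb{C},\ |y|\le \sqrt{Q}/|t|}\big|\{q\in\mathcal{S}_t\cap B(y,u): q\equiv l \bmod k\}\big|.$$ *)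

theory Defs
  imports "HOL-Analysis.Analysis"
begin

definition GI :: "complex set" where
  "GI = {z. Re z \<in> \<int> \<and> Im z \<in> \<int>}"

definition gnorm :: "complex \<Rightarrow> real" where
  "gnorm q = (Re q)\<^sup>2 + (Im q)\<^sup>2"

definition ee :: "real \<Rightarrow> complex" where
  "ee x = exp (2 * of_real pi * \<i> * of_real x)"

definition gdvd :: "complex \<Rightarrow> complex \<Rightarrow> bool" where
  "gdvd d a \<longleftrightarrow> (\<exists>m\<in>GI. a = d * m)"

definition gunit :: "complex \<Rightarrow> bool" where
  "gunit u \<longleftrightarrow> u \<in> GI \<and> gdvd u 1"

definition gcoprime :: "complex \<Rightarrow> complex \<Rightarrow> bool" where
  "gcoprime a b \<longleftrightarrow> (\<forall>d\<in>GI. gdvd d a \<and> gdvd d b \<longrightarrow> gunit d)"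

definition gcong :: "complex \<Rightarrow> complex \<Rightarrow> complex \<Rightarrow> bool" where
  "gcong a b k \<longleftrightarrow> gdvd k (a - b)"

definition reduced_residue_system :: "complex \<Rightarrow> complex set \<Rightarrow> bool" where
  "reduced_residue_system q R \<longleftrightarrow>
     R \<subseteq> GI \<and> (\<forall>a\<in>R. gcoprime a q) \<and>
     (\<forall>a\<in>R. \<forall>b\<in>R. gcong a b q \<longrightarrow> a = b) \<and>
     (\<forall>a\<in>GI. gcoprime a q \<longrightarrow> (\<exists>b\<in>R. gcong a b q))"

definition S_t :: "complex set \<Rightarrow> complex \<Rightarrow> complex set" where
  "S_t S t = {q\<in>GI. t * q \<in> S}"

definition A_t :: "complex set \<Rightarrow> nat \<Rightarrow> complex \<Rightarrow> real \<Rightarrow> complex \<Rightarrow> complex \<Rightarrow> real" where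
  "A_t S Q t u k l =
     Sup ((\<lambda>y. real (card {q \<in> S_t S t \<inter> cball y u. gcong q l k}))
          ` {y. cmod y \<le> sqrt (real Q) / cmod t})"

end

theory Submission
  imports Defs
begin

text \<open>By duality and a majorant built from squared Dirichlet kernels, the large sieve reduces the
  claim to a bound for the number \<open>K\<close> of fractions \<open>a / q\<close> with \<open>q \<in> S\<close> in a disc of radius
  \<open>N powr (- 1 / 2)\<close> around a point \<open>\<gamma>\<close>. Approximate \<open>\<gamma>\<close> by \<open>b / r\<close> with \<open>\<bar>r\<bar> \<le> T = N powr (1 / 4)\<close> and
  \<open>\<bar>r * \<gamma> - b\<bar> \<le> 8 / T\<close>. The pairs with \<open>a * r = b * q\<close> number at most four. The others are sorted
  by \<open>t = gcd (a * r - b * q) r\<close>: with \<open>a * r - b * q = t * m\<close>, \<open>r = t * k\<close> and \<open>q = t * q'\<close>, each \<open>m\<close>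
  leaves for \<open>q'\<close> one residue class modulo \<open>k\<close> in a disc, to which the hypothesis on
  \<open>A_t\<close> applies. Summing over \<open>m\<close> gives the same bound for every \<open>t\<close>, and the number of divisors \<open>t\<close>
  of \<open>r\<close> is \<open>O(N powr \<epsilon>)\<close>.\<close>

section \<open>Arithmetic of the Gaussian integers\<close>

text \<open>The scale \<open>T\<close> serves two ends: \<open>1 / T\<^sup>2\<close> is the radius
  of the sieve, and pigeonhole in two real dimensions approximates with error of order
  \<open>1 / T\<close> by multipliers of modulus at most \<open>T\<close>. Pairs with
  \<open>a * r = b * q\<close> are counted separately because nonzero \<open>m\<close> in a disc of
  radius \<open>\<rho>\<close> number at most a multiple of \<open>\<rho>\<^sup>2\<close>, whereas a
  term for \<open>m = 0\<close> would not shrink with \<open>\<rho>\<close>. These pairs are the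
  source of the summand \<open>N\<close> in the result. Sorting by the gcd serves the hypothesis,
  which admits only classes \<open>l\<close> coprime to \<open>k\<close>: once \<open>t\<close> is
  divided out, \<open>m\<close> is coprime to \<open>k\<close>, and so is the class
  \<open>- (x * m)\<close>, where \<open>x\<close> inverts \<open>b\<close> modulo \<open>k\<close>.
  The hypothesis also confines \<open>u\<close> to an interval, so the radius natural for a given
  \<open>m\<close> must be clamped into it; the quality of the approximation makes this cost only a
  constant. The bound is uniform in \<open>t\<close> because \<open>k\<close> and \<open>t\<close>
  cancel from the main term once the number of \<open>m\<close> is multiplied by the bound for
  each.\<close>

lemma GI_0 [simp]: "0 \<in> GI" and GI_1 [simp]: "1 \<in> GI"
  by (auto simp: GI_def)

lemma GI_add [simp]: "a \<in> GI \<Longrightarrow> b \<in> GI \<Longrightarrow> a + b \<in> GI"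
  and GI_diff [simp]: "a \<in> GI \<Longrightarrow> b \<in> GI \<Longrightarrow> a - b \<in> GI"
  and GI_uminus [simp]: "a \<in> GI \<Longrightarrow> - a \<in> GI"
  and GI_mult [simp]: "a \<in> GI \<Longrightarrow> b \<in> GI \<Longrightarrow> a * b \<in> GI"
  by (auto simp: GI_def)

lemma GI_power [simp]: "a \<in> GI \<Longrightarrow> a ^ n \<in> GI"
  by (induction n) auto

lemma gnorm_eq: "gnorm q = (cmod q)\<^sup>2"
  by (simp add: gnorm_def cmod_power2)

lemma GI_Complex [simp]: "Complex (of_int x) (of_int y) \<in> GI"
  by (auto simp: GI_def)

lemma GI_E:
  assumes "a \<in> GI"
  obtains x y where "a = Complex (of_int x) (of_int y)"
  using assms by (metis (mono_tags, lifting) GI_def Ints_cases complex.collapse mem_Collect_eq)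

lemma GI_norm_ge_1:
  assumes "a \<in> GI" "a \<noteq> 0"
  shows "1 \<le> cmod a"
proof -
  obtain x y where a: "a = Complex (of_int x) (of_int y)"
    using assms by (auto elim: GI_E)
  have "0 < x\<^sup>2 + y\<^sup>2"
    using assms(2) by (auto simp: a sum_power2_gt_zero_iff complex_eq_iff)
  hence "1 \<le> x\<^sup>2 + y\<^sup>2" by simp
  hence "1 \<le> real_of_int (x\<^sup>2 + y\<^sup>2)" by linarith
  thus ?thesis
    by (simp add: a complex_norm)
qed

text \<open>Each coordinate contributes at most 1/4 to the square. A total below 1 is what makes
  division with remainder possible.\<close>

lemma GI_round: "\<exists>g\<in>GI. (cmod (w - g))\<^sup>2 \<le> 1 / 2"
proof (intro bexI)
  let ?g = "Complex (of_int (round (Re w))) (of_int (round (Im w)))"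
  have "\<bar>Re w - of_int (round (Re w))\<bar> \<le> 1/2" "\<bar>Im w - of_int (round (Im w))\<bar> \<le> 1/2"
    using of_int_round_abs_le by (auto simp: abs_minus_commute)
  hence "(Re w - of_int (round (Re w)))\<^sup>2 \<le> (1/2)\<^sup>2" "(Im w - of_int (round (Im w)))\<^sup>2 \<le> (1/2)\<^sup>2"
    by (simp_all flip: abs_le_square_iff)
  thus "(cmod (w - ?g))\<^sup>2 \<le> 1 / 2"
    unfolding cmod_power2 by (simp add: power_divide)
qed auto

text \<open>Excluding 0 keeps the count free of an additive constant: below radius 1 nothing is
  left, and from there on \<open>2 * \<lfloor>\<rho>\<rfloor> + 1\<close> is at most
  \<open>3 * \<rho>\<close>.\<close>

lemma GI_disc:
  fixes \<rho> :: real
  shows "finite {m\<in>GI. cmod m \<le> \<rho>}"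
    and "real (card {m\<in>GI. m \<noteq> 0 \<and> cmod m \<le> \<rho>}) \<le> 9 * \<rho>\<^sup>2"
proof -
  let ?I = "{-\<lfloor>\<rho>\<rfloor>..\<lfloor>\<rho>\<rfloor>}"
  let ?f = "\<lambda>(x, y). Complex (of_int x) (of_int y)"
  have sub: "{m\<in>GI. cmod m \<le> \<rho>} \<subseteq> ?f ` (?I \<times> ?I)"
  proof
    fix m assume m: "m \<in> {m\<in>GI. cmod m \<le> \<rho>}"
    then obtain x y where xy: "m = Complex (of_int x) (of_int y)" by (auto elim: GI_E)
    have "\<bar>of_int x\<bar> \<le> \<rho>" "\<bar>of_int y\<bar> \<le> \<rho>"
      using m abs_Re_le_cmod[of m] abs_Im_le_cmod[of m] xy by auto
    hence "x \<in> ?I" "y \<in> ?I" by (auto simp: le_floor_iff) linarith+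
    thus "m \<in> ?f ` (?I \<times> ?I)" using xy by force
  qed
  show fin: "finite {m\<in>GI. cmod m \<le> \<rho>}"
    by (rule finite_subset[OF sub]) auto
  show "real (card {m\<in>GI. m \<noteq> 0 \<and> cmod m \<le> \<rho>}) \<le> 9 * \<rho>\<^sup>2"
  proof (cases "\<rho> < 1")
    case True
    have "{m\<in>GI. m \<noteq> 0 \<and> cmod m \<le> \<rho>} = {}" using GI_norm_ge_1 True by fastforce
    thus ?thesis by (simp only: card.empty) simp
  next
    case False
    have "card {m\<in>GI. m \<noteq> 0 \<and> cmod m \<le> \<rho>} \<le> card (?f ` (?I \<times> ?I))"
      by (rule card_mono) (use sub in auto)
    also have "\<dots> \<le> card (?I \<times> ?I)" by (rule card_image_le) auto
    also have "\<dots> = (nat (2 * \<lfloor>\<rho>\<rfloor> + 1))\<^sup>2"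
      by (simp add: card_cartesian_product power2_eq_square)
    finally have "real (card {m\<in>GI. m \<noteq> 0 \<and> cmod m \<le> \<rho>}) \<le> real ((nat (2 * \<lfloor>\<rho>\<rfloor> + 1))\<^sup>2)"
      using of_nat_mono by blast
    also have "\<dots> = (2 * of_int \<lfloor>\<rho>\<rfloor> + 1)\<^sup>2"
      using False by (simp add: of_nat_nat)
    also have "\<dots> \<le> (3 * \<rho>)\<^sup>2"
      using False by (intro power_mono) linarith+
    finally show ?thesis by (simp add: power_mult_distrib)
  qed
qed

text \<open>Discs hold finitely many Gaussian integers, so a least modulus is attained although
  \<open>cmod\<close> is real-valued. This stands in for induction: it yields gcds, prime divisors,
  full prime powers and minimal counterexamples.\<close>

lemma GI_min_norm:
  assumes "A \<subseteq> GI" "x \<in> A"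
  obtains m where "m \<in> A" "\<And>y. y \<in> A \<Longrightarrow> cmod m \<le> cmod y"
proof -
  let ?B = "{y\<in>A. cmod y \<le> cmod x}"
  have fin: "finite ?B" 
    by (rule finite_subset[OF _ GI_disc(1)[of "cmod x"]]) (use assms in auto)
  have ne: "?B \<noteq> {}" using assms by auto
  define m where "m = arg_min_on cmod ?B"
  have "m \<in> ?B" unfolding m_def by (rule arg_min_if_finite[OF fin ne])
  moreover have "cmod m \<le> cmod y" if "y \<in> A" for y
  proof (cases "cmod y \<le> cmod x")
    case True thus ?thesis unfolding m_def using fin ne that by (intro arg_min_least) auto
  next
    case False thus ?thesis using \<open>m \<in> ?B\<close> by auto
  qed
  ultimately show ?thesis using that by auto
qed

section \<open>Divisibility, units and Bezout identities\<close>

lemma gdvd_refl [simp]: "gdvd a a"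
  unfolding gdvd_def by (rule bexI[of _ 1]) auto

lemma gdvd_trans: "gdvd a b \<Longrightarrow> gdvd b c \<Longrightarrow> gdvd a c"
  unfolding gdvd_def by (auto simp: mult.assoc)

lemma gdvd_add: "gdvd d a \<Longrightarrow> gdvd d b \<Longrightarrow> gdvd d (a + b)"
  unfolding gdvd_def by (auto simp flip: distrib_left)

lemma gdvd_mult: "gdvd d a \<Longrightarrow> b \<in> GI \<Longrightarrow> gdvd d (a * b)"
  unfolding gdvd_def by (auto simp: mult.assoc)

lemma gdvd_mult2: "gdvd d a \<Longrightarrow> b \<in> GI \<Longrightarrow> gdvd d (b * a)"
  by (metis gdvd_mult mult.commute)

lemma gdvd_triv [simp]: "b \<in> GI \<Longrightarrow> gdvd a (a * b)"
  by (auto simp: gdvd_def)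

lemma gdvd_uminus: "gdvd d a \<Longrightarrow> gdvd d (- a)"
  using gdvd_mult[of d a "- 1"] by simp

lemma gdvd_norm_le:
  assumes "gdvd d a" "a \<noteq> 0"
  shows "cmod d \<le> cmod a"
proof -
  obtain m where m: "m \<in> GI" "a = d * m" using assms by (auto simp: gdvd_def)
  hence "1 \<le> cmod m" using assms GI_norm_ge_1[of m] by auto
  hence "cmod d * 1 \<le> cmod d * cmod m" by (intro mult_left_mono) auto
  thus ?thesis using m by (simp add: norm_mult)
qed

lemma gunit_iff: "gunit u \<longleftrightarrow> u \<in> {1, -1, \<i>, -\<i>}"
proof
  assume "gunit u"
  then obtain v where uv: "u \<in> GI" "v \<in> GI" "u * v = 1" by (auto simp: gunit_def gdvd_def)
  hence "u \<noteq> 0" by auto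
  have "cmod u \<le> 1"
    using \<open>gunit u\<close> gdvd_norm_le[of u 1] by (auto simp: gunit_def)
  hence u1: "(cmod u)\<^sup>2 = 1" using GI_norm_ge_1[of u] uv(1) \<open>u \<noteq> 0\<close> by auto
  obtain x y where xy: "u = Complex (of_int x) (of_int y)" using uv(1) by (auto elim: GI_E)
  have "x\<^sup>2 + y\<^sup>2 = 1" 
  proof -
    have "real_of_int (x\<^sup>2 + y\<^sup>2) = 1" using u1 by (simp add: xy cmod_power2)
    thus ?thesis by linarith
  qed
  moreover from this have "x\<^sup>2 \<le> 1" "y\<^sup>2 \<le> 1"
    using zero_le_power2[of x] zero_le_power2[of y] by linarith+
  hence "\<bar>x\<bar> \<le> 1" "\<bar>y\<bar> \<le> 1"
    by (simp_all add: abs_square_le_1)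
  hence "x = -1 \<or> x = 0 \<or> x = 1" "y = -1 \<or> y = 0 \<or> y = 1" by arith+
  ultimately show "u \<in> {1, -1, \<i>, -\<i>}"
    by (auto simp: xy complex_eq_iff)
next
  assume "u \<in> {1, -1, \<i>, -\<i>}"
  hence "u \<in> GI" "1 = u * cnj u" "cnj u \<in> GI" by (auto simp: GI_def)
  thus "gunit u" unfolding gunit_def gdvd_def by blast
qed

text \<open>A nonzero combination of \<open>a\<close> and \<open>b\<close> of least modulus divides
  all combinations: the remainder after rounding the quotient is again a combination, and strictly
  smaller.\<close>

lemma GI_bezout:
  assumes "a \<in> GI" "b \<in> GI" "a \<noteq> 0 \<or> b \<noteq> 0"
  obtains g x y where "g \<in> GI" "g \<noteq> 0" "x \<in> GI" "y \<in> GI" "g = a * x + b * y" "gdvd g a" "gdvd g b"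
proof -
  define I where "I = {a * x + b * y |x y. x \<in> GI \<and> y \<in> GI}"
  have I_lin: "u + v * w \<in> I" if "u \<in> I" "v \<in> I" "w \<in> GI" for u v w
  proof -
    from that obtain x y x' y' where *: "u = a * x + b * y" "v = a * x' + b * y'"
      "x \<in> GI" "y \<in> GI" "x' \<in> GI" "y' \<in> GI" unfolding I_def by auto
    have "u + v * w = a * (x + x' * w) + b * (y + y' * w)" using * by (simp add: algebra_simps)
    moreover have "x + x' * w \<in> GI" "y + y' * w \<in> GI" using * that by auto
    ultimately show ?thesis unfolding I_def by blast
  qed
  have "a = a * 1 + b * 0" "b = a * 0 + b * 1" by auto
  hence ab: "a \<in> I" "b \<in> I" unfolding I_def using GI_0 GI_1 by blast+
  have "I \<subseteq> GI" using assms by (auto simp: I_def)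
  hence "I - {0} \<subseteq> GI" by auto
  moreover obtain c where "c \<in> I - {0}" using ab assms by blast
  ultimately obtain g where g: "g \<in> I - {0}" "\<And>y. y \<in> I - {0} \<Longrightarrow> cmod g \<le> cmod y"
    using GI_min_norm by blast
  have dvd: "gdvd g c" if c: "c \<in> I" for c
  proof -
    obtain h where h: "h \<in> GI" "(cmod (c / g - h))\<^sup>2 \<le> 1 / 2" using GI_round by blast
    have "cmod (c / g - h) < 1"
    proof (rule ccontr)
      assume "\<not> ?thesis"
      hence "1 \<le> (cmod (c / g - h))\<^sup>2" by (simp add: one_le_power)
      with h show False by simp
    qed
    moreover have "c + g * (- h) = g * (c / g - h)" using g by (simp add: field_simps)
    ultimately have "cmod (c + g * (- h)) < cmod g" using g by (simp add: norm_mult)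
    moreover have "c + g * (- h) \<in> I" using I_lin[OF c, of g "- h"] g h by auto
    ultimately have "c + g * (- h) = 0" using g(2)[of "c + g * (- h)"] by auto
    hence "c = g * h" by simp
    thus ?thesis using h by (auto simp: gdvd_def)
  qed
  from g obtain x y where "x \<in> GI" "y \<in> GI" "g = a * x + b * y" unfolding I_def by auto
  thus ?thesis using that[of g x y] g \<open>I \<subseteq> GI\<close> dvd ab by auto
qed

lemma gcoprime_bezout:
  assumes "gcoprime a b" "a \<in> GI" "b \<in> GI"
  obtains x y where "x \<in> GI" "y \<in> GI" "a * x + b * y = 1"
proof -
  have "a \<noteq> 0 \<or> b \<noteq> 0"
  proof (rule ccontr)
    assume "\<not> ?thesis"
    hence "gunit 0" using assms(1) by (auto simp: gcoprime_def)
    thus False by (simp add: gunit_iff)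
  qed
  from GI_bezout[OF assms(2,3) this] obtain g x y where g: "g \<in> GI" "x \<in> GI" "y \<in> GI"
    "g = a * x + b * y" "gdvd g a" "gdvd g b" by metis
  hence "gunit g" using assms(1) by (auto simp: gcoprime_def)
  then obtain v where v: "v \<in> GI" "g * v = 1" by (auto simp: gunit_def gdvd_def)
  hence "a * (x * v) + b * (y * v) = 1" using g(4) by (simp add: algebra_simps)
  thus ?thesis using that[of "x * v" "y * v"] v g by auto
qed

lemma gcoprimeI_bezout:
  assumes "a * x + b * y = 1" "x \<in> GI" "y \<in> GI"
  shows "gcoprime a b"
proof -
  have "gdvd d 1" if "gdvd d a" "gdvd d b" for d
    using gdvd_add[OF gdvd_mult[OF that(1) assms(2)] gdvd_mult[OF that(2) assms(3)]] assms(1) by simp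
  thus ?thesis by (simp add: gcoprime_def gunit_def)
qed

lemma gcoprime_gdvd_mult:
  assumes "gcoprime a b" "a \<in> GI" "b \<in> GI" "c \<in> GI" "gdvd b (a * c)"
  shows "gdvd b c"
proof -
  obtain x y where xy: "x \<in> GI" "y \<in> GI" "a * x + b * y = 1"
    using gcoprime_bezout assms by metis
  have "(a * c) * x + b * (y * c) = (a * x + b * y) * c" by (simp add: algebra_simps)
  hence "c = (a * c) * x + b * (y * c)" using xy(3) by simp
  moreover have "gdvd b ((a * c) * x + b * (y * c))"
    using xy assms by (intro gdvd_add gdvd_mult[OF assms(5)] gdvd_triv) auto
  ultimately show ?thesis by simp
qed

lemma gcoprime_commute: "gcoprime a b \<longleftrightarrow> gcoprime b a"
  unfolding gcoprime_def by blast

section \<open>The divisor bound\<close>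

lemma gunit_norm_1:
  assumes "p \<in> GI" "cmod p = 1"
  shows "gunit p"
proof -
  have "p * cnj p = 1" using assms by (simp add: complex_norm_square[symmetric])
  moreover have "cnj p \<in> GI" using assms by (auto simp: GI_def)
  ultimately show ?thesis using assms unfolding gunit_def gdvd_def by metis
qed

lemma nonunit_norm_ge:
  assumes "p \<in> GI" "p \<noteq> 0" "\<not> gunit p"
  shows "sqrt 2 \<le> cmod p"
proof -
  obtain x y where p: "p = Complex (of_int x) (of_int y)"
    using assms by (auto elim: GI_E)
  have np: "cmod p = sqrt (real_of_int (x\<^sup>2 + y\<^sup>2))" by (simp add: p complex_norm)
  have "x\<^sup>2 + y\<^sup>2 \<noteq> 1"
  proof
    assume "x\<^sup>2 + y\<^sup>2 = 1"
    hence "cmod p = 1" unfolding np by (simp only: of_int_1 real_sqrt_one)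
    thus False using gunit_norm_1 assms by auto
  qed
  moreover have "x\<^sup>2 + y\<^sup>2 \<noteq> 0" using np assms by auto
  moreover have "0 \<le> x\<^sup>2 + y\<^sup>2" by simp
  ultimately have "2 \<le> x\<^sup>2 + y\<^sup>2" by linarith
  hence "2 \<le> real_of_int (x\<^sup>2 + y\<^sup>2)" by linarith
  thus ?thesis unfolding np by (rule real_sqrt_le_mono)
qed

text \<open>A nonunit divisor of least modulus is prime: a nonunit gcd of \<open>p\<close> and
  \<open>a\<close> would be no smaller than \<open>p\<close>, hence an associate of
  \<open>p\<close>, and \<open>p\<close> would divide \<open>a\<close>. Otherwise Bezout
  applies.\<close>

lemma GI_prime_divisor:
  assumes "r \<in> GI" "r \<noteq> 0" "\<not> gunit r"
  obtains p where "p \<in> GI" "p \<noteq> 0" "gdvd p r" "\<not> gunit p"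
    "\<And>a b. a \<in> GI \<Longrightarrow> b \<in> GI \<Longrightarrow> gdvd p (a * b) \<Longrightarrow> gdvd p a \<or> gdvd p b"
proof -
  let ?A = "{p\<in>GI. gdvd p r \<and> \<not> gunit p}"
  have "?A \<subseteq> GI" "r \<in> ?A" using assms by auto
  then obtain p where p: "p \<in> ?A" "\<And>y. y \<in> ?A \<Longrightarrow> cmod p \<le> cmod y"
    using GI_min_norm by blast
  have p0: "p \<noteq> 0" using p(1) assms(2) by (auto simp: gdvd_def)
  have "gdvd p b" if ab: "a \<in> GI" "b \<in> GI" "gdvd p (a * b)" and na: "\<not> gdvd p a" for a b
  proof -
    obtain g x y where g: "g \<in> GI" "g \<noteq> 0" "x \<in> GI" "y \<in> GI" "g = p * x + a * y" "gdvd g p" "gdvd g a"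
      using GI_bezout[of p a] p p0 ab by auto
    have "gunit g"
    proof (rule ccontr)
      assume "\<not> gunit g"
      hence le: "cmod p \<le> cmod g" using p g by (auto intro: gdvd_trans)
      obtain h where h: "h \<in> GI" "p = g * h" using g by (auto simp: gdvd_def)
      have "cmod g * cmod h \<le> cmod g * 1" using le h by (simp add: norm_mult)
      hence "cmod h \<le> 1" using g by (subst (asm) mult_le_cancel_left) auto
      hence "cmod h = 1" using GI_norm_ge_1[of h] h p0 by auto
      hence "gunit h" using h gunit_norm_1 by auto
      then obtain v where v: "v \<in> GI" "h * v = 1" by (auto simp: gunit_def gdvd_def)
      hence "g = p * v" using h by (simp add: mult.assoc)
      hence "gdvd p g" using v by (auto simp: gdvd_def)
      thus False using g na gdvd_trans by blast
    qed
    then obtain v where v: "v \<in> GI" "g * v = 1" by (auto simp: gunit_def gdvd_def)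
    hence "p * (x * v) + a * (y * v) = 1" using g(5) by (simp add: algebra_simps)
    hence "gcoprime p a" using gcoprimeI_bezout v g by auto
    thus ?thesis using gcoprime_gdvd_mult[of a p b] ab p by (auto simp: gcoprime_commute)
  qed
  thus ?thesis using that[of p] p p0 by blast
qed

text \<open>A cofactor of least modulus contains no further \<open>p\<close>, since splitting one
  off divides the modulus by at least \<open>sqrt 2\<close>.\<close>

lemma GI_multiplicity:
  assumes "p \<in> GI" "p \<noteq> 0" "\<not> gunit p" "r \<in> GI" "r \<noteq> 0"
  obtains e s where "r = p ^ e * s" "s \<in> GI" "\<not> gdvd p s"
proof -
  define A where "A = {s\<in>GI. \<exists>e. r = p ^ e * s}"
  have "r \<in> A" using assms(4) by (auto simp: A_def intro: exI[of _ 0])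
  moreover have "A \<subseteq> GI" by (auto simp: A_def)
  ultimately obtain s where s: "s \<in> A" "\<And>y. y \<in> A \<Longrightarrow> cmod s \<le> cmod y"
    using GI_min_norm by blast
  then obtain e where e: "r = p ^ e * s" "s \<in> GI" by (auto simp: A_def)
  have "\<not> gdvd p s"
  proof
    assume "gdvd p s"
    then obtain w where w: "w \<in> GI" "s = p * w" by (auto simp: gdvd_def)
    hence "r = p ^ Suc e * w" using e by (simp add: mult_ac)
    hence "w \<in> A" using w unfolding A_def by blast
    hence "cmod p * cmod w \<le> 1 * cmod w" using s(2)[of w] w by (simp add: norm_mult)
    moreover have "w \<noteq> 0" using assms e w by auto
    ultimately have "cmod p \<le> 1" by (subst (asm) mult_le_cancel_right) auto
    moreover have "1 < sqrt 2" by simp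
    ultimately show False using nonunit_norm_ge[of p] assms by linarith
  qed
  thus ?thesis using that e by blast
qed

lemma gdivs_finite: "r \<noteq> 0 \<Longrightarrow> finite {t\<in>GI. gdvd t r}"
  by (rule finite_subset[OF _ GI_disc(1)[of "cmod r"]]) (auto dest: gdvd_norm_le)

text \<open>Every divisor is \<open>p ^ j * w\<close> with \<open>j \<le> e\<close> and
  \<open>w\<close> a divisor of \<open>s\<close>, so \<open>e + 1\<close> scaled copies of the
  divisors of \<open>s\<close> cover them all.\<close>

lemma card_gdivs_prime_power:
  assumes p: "p \<in> GI" "p \<noteq> 0" "\<not> gunit p"
    and prime: "\<And>a b. a \<in> GI \<Longrightarrow> b \<in> GI \<Longrightarrow> gdvd p (a * b) \<Longrightarrow> gdvd p a \<or> gdvd p b"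
    and s: "s \<in> GI" "s \<noteq> 0" "\<not> gdvd p s"
  shows "card {t\<in>GI. gdvd t (p ^ e * s)} \<le> (e + 1) * card {t\<in>GI. gdvd t s}"
proof -
  \<comment> \<open>A divisor \<open>t\<close> free of \<open>p\<close> sheds the power one factor
    at a time: primality pushes each \<open>p\<close> into the cofactor \<open>m\<close>, where it
    cancels.\<close>
  have strip: "gdvd t s" if "t \<in> GI" "\<not> gdvd p t" "gdvd t (p ^ i * s)" for t i
    using that(3)
  proof (induction i)
    case (Suc i)
    then obtain m where m: "m \<in> GI" "p ^ Suc i * s = t * m" by (auto simp: gdvd_def)
    have "gdvd p (t * m)" 
      using gdvd_triv[of "p ^ i * s" p] p s by (simp flip: m(2) add: mult.assoc)
    hence "gdvd p m" using prime[of t m] that m by blast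
    then obtain m' where m': "m' \<in> GI" "m = p * m'" by (auto simp: gdvd_def)
    hence "p ^ i * s = t * m'" using m(2) p by (simp add: mult_ac)
    thus ?case using Suc.IH m' by (auto simp: gdvd_def)
  qed auto
  have "{t\<in>GI. gdvd t (p ^ e * s)} \<subseteq> (\<Union>j\<in>{..e}. (\<lambda>t. p ^ j * t) ` {t\<in>GI. gdvd t s})"
  proof
    fix t assume "t \<in> {t\<in>GI. gdvd t (p ^ e * s)}"
    hence t: "t \<in> GI" "gdvd t (p ^ e * s)" by auto
    then obtain m where m: "m \<in> GI" "p ^ e * s = t * m" by (auto simp: gdvd_def)
    have "t \<noteq> 0" using m p s by auto
    then obtain j w where w: "t = p ^ j * w" "w \<in> GI" "\<not> gdvd p w"
      using GI_multiplicity[OF p t(1)] by metis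
    have "j \<le> e"
    proof (rule ccontr)
      assume "\<not> j \<le> e"
      then obtain i where i: "j = e + Suc i" by (metis add_Suc_right less_imp_Suc_add not_le)
      have "p ^ e * s = p ^ e * (p * (p ^ i * w * m))" using m w i by (simp add: power_add mult_ac)
      hence "s = p * (p ^ i * w * m)" using p by simp
      thus False using s p w m by (metis GI_mult GI_power gdvd_triv)
    qed
    hence "p ^ e = p ^ j * p ^ (e - j)" by (simp flip: power_add)
    hence "p ^ j * (p ^ (e - j) * s) = p ^ j * (w * m)" using m w by (simp add: mult.assoc)
    hence "p ^ (e - j) * s = w * m" using p by simp
    hence "gdvd w (p ^ (e - j) * s)" using m by (auto simp: gdvd_def)
    hence "gdvd w s" using strip w by blast
    thus "t \<in> (\<Union>j\<in>{..e}. (\<lambda>t. p ^ j * t) ` {t\<in>GI. gdvd t s})" using w \<open>j \<le> e\<close> by blast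
  qed
  moreover have fin: "finite {t\<in>GI. gdvd t s}" using gdivs_finite s by auto
  ultimately have "card {t\<in>GI. gdvd t (p ^ e * s)} \<le> card (\<Union>j\<in>{..e}. (\<lambda>t. p ^ j * t) ` {t\<in>GI. gdvd t s})"
    by (intro card_mono) auto
  also have "\<dots> \<le> (\<Sum>j\<in>{..e}. card ((\<lambda>t. p ^ j * t) ` {t\<in>GI. gdvd t s}))"
    by (rule card_UN_le) auto
  also have "\<dots> \<le> (\<Sum>j\<in>{..e}. card {t\<in>GI. gdvd t s})"
    by (intro sum_mono card_image_le fin)
  finally show ?thesis by simp
qed

text \<open>Removing the full power \<open>p ^ e\<close> of a prime multiplies the divisor count by at most
  \<open>e + 1\<close>. For \<open>\<bar>p\<bar> \<ge> 2 powr (1 / \<delta>)\<close> this factor is absorbed by \<open>\<bar>p\<bar> powr (\<delta> * e)\<close>; the boundedly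
  many smaller primes each cost a constant \<open>c\<close>.\<close>

lemma card_gdivs_le:
  fixes \<delta> :: real
  assumes "\<delta> > 0"
  obtains C where "C > 0" "\<And>r. r \<in> GI \<Longrightarrow> r \<noteq> 0 \<Longrightarrow> real (card {t\<in>GI. gdvd t r}) \<le> C * cmod r powr \<delta>"
proof -
  \<comment> \<open>\<open>x\<close> bounds \<open>cmod p powr \<delta>\<close> from below for every
    nonzero nonunit \<open>p\<close>, and \<open>c\<close> is chosen so that Bernoulli gives
    \<open>1 + e \<le> c * x ^ e\<close>. \<open>B\<close> is the threshold where
    \<open>B powr \<delta> = 2\<close>, enough for \<open>1 + e \<le> 2 ^ e\<close>.\<close>
  define x where "x = sqrt 2 powr \<delta>"
  define c where "c = max 1 (1 / (x - 1))"
  define B where "B = 2 powr (1 / \<delta>)"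
  \<comment> \<open>All small divisors are collected, prime or not: it suffices that removing
    \<open>p ^ e\<close> takes a small \<open>p\<close> itself out of the set.\<close>
  define W where "W r = {w\<in>GI. cmod w \<le> B \<and> gdvd w r}" for r
  have x1: "x > 1" unfolding x_def using assms by (intro gr_one_powr) auto
  have c1: "c \<ge> 1" by (simp add: c_def)
  have cx: "1 + real e \<le> c * x ^ e" for e
  proof -
    have "1 \<le> c * (x - 1)" using x1 by (simp add: c_def max_def field_simps)
    hence "real e * 1 \<le> real e * (c * (x - 1))" by (intro mult_left_mono) auto
    hence "1 + real e \<le> c * (1 + real e * (x - 1))" using c1 by (simp add: algebra_simps)
    also have "\<dots> \<le> c * (1 + (x - 1)) ^ e"
      using c1 x1 by (intro mult_left_mono Bernoulli_inequality) auto
    finally show ?thesis by simp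
  qed
  have finW: "finite (W r)" for r
    unfolding W_def by (rule finite_subset[OF _ GI_disc(1)[of B]]) auto
  have key: "real (card {t\<in>GI. gdvd t r}) \<le> 4 * c ^ card (W r) * cmod r powr \<delta>"
    if "r \<in> GI" "r \<noteq> 0" for r
  proof (rule ccontr)
    \<comment> \<open>A counterexample of least modulus replaces induction on \<open>r\<close>; the
      factor 4 counts the units.\<close>
    let ?A = "{r\<in>GI - {0}. \<not> real (card {t\<in>GI. gdvd t r}) \<le> 4 * c ^ card (W r) * cmod r powr \<delta>}"
    assume "\<not> ?thesis"
    hence "r \<in> ?A" using that by auto
    moreover have "?A \<subseteq> GI" by auto
    ultimately obtain r where "r \<in> ?A" and min: "\<And>y. y \<in> ?A \<Longrightarrow> cmod r \<le> cmod y"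
      using GI_min_norm by blast
    hence r: "r \<in> GI" "r \<noteq> 0" and not: "\<not> real (card {t\<in>GI. gdvd t r}) \<le> 4 * c ^ card (W r) * cmod r powr \<delta>"
      by auto
    show False
    proof (cases "gunit r")
      case True
      have "{t\<in>GI. gdvd t r} \<subseteq> {1, -1, \<i>, -\<i>}"
      proof
        fix t assume "t \<in> {t\<in>GI. gdvd t r}"
        hence "gunit t" using True gdvd_trans[of t r 1] by (auto simp: gunit_def)
        thus "t \<in> {1, -1, \<i>, -\<i>}" by (simp only: gunit_iff)
      qed
      hence "card {t\<in>GI. gdvd t r} \<le> card {1, -1, \<i>, -\<i>}" by (intro card_mono) auto
      also have "\<dots> \<le> 4" by (simp add: card_insert_if)
      finally have "real (card {t\<in>GI. gdvd t r}) \<le> 4 * 1 * 1" by simp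
      also have "\<dots> \<le> 4 * c ^ card (W r) * cmod r powr \<delta>"
        using c1 GI_norm_ge_1[OF r] assms by (intro mult_mono ge_one_powr_ge_zero) auto
      finally show False using not by blast
    next
      case False
      obtain p where p: "p \<in> GI" "p \<noteq> 0" "gdvd p r" "\<not> gunit p"
        and prime: "\<And>a b. a \<in> GI \<Longrightarrow> b \<in> GI \<Longrightarrow> gdvd p (a * b) \<Longrightarrow> gdvd p a \<or> gdvd p b"
        using GI_prime_divisor[OF r False] by metis
      obtain e s where s: "r = p ^ e * s" "s \<in> GI" "\<not> gdvd p s"
        using GI_multiplicity[OF p(1,2,4) r] by metis
      have s0: "s \<noteq> 0" using r s by auto
      have "e \<noteq> 0" using s p by (auto intro!: Nat.gr0I)
      have p2: "sqrt 2 \<le> cmod p" using nonunit_norm_ge p by auto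
      have "1 < cmod p" using p2 by (rule less_le_trans[rotated]) simp
      hence "1 < cmod p ^ e" using \<open>e \<noteq> 0\<close> by (simp add: one_less_power)
      hence "cmod s < cmod r" using s s0 by (simp add: norm_mult norm_power)
      hence "s \<notin> ?A" using min by force
      hence IH: "real (card {t\<in>GI. gdvd t s}) \<le> 4 * c ^ card (W s) * cmod s powr \<delta>"
        using s s0 by auto
      have Wsub: "W s \<subseteq> W r" unfolding W_def s(1) using p s by (auto intro: gdvd_mult2)
      have rnorm: "cmod r powr \<delta> = (cmod p powr \<delta>) ^ e * cmod s powr \<delta>"
        using s p by (simp add: norm_mult norm_power powr_mult powr_power powr_powr mult.commute flip: powr_realpow)
      have "(1 + real e) * c ^ card (W s) \<le> c ^ card (W r) * (cmod p powr \<delta>) ^ e"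
      proof (cases "cmod p \<le> B")
        case True
        hence "p \<in> W r - W s" using p s by (auto simp: W_def)
        hence "card (W s) < card (W r)" using Wsub finW by (intro psubset_card_mono) auto
        hence "c ^ Suc (card (W s)) \<le> c ^ card (W r)" using c1 by (intro power_increasing) auto
        moreover have "x ^ e \<le> (cmod p powr \<delta>) ^ e"
          unfolding x_def using p2 assms by (intro power_mono powr_mono2) auto
        moreover have "(1 + real e) * c ^ card (W s) \<le> (c * x ^ e) * c ^ card (W s)"
          using c1 cx by (intro mult_right_mono) auto
        moreover have "c ^ Suc (card (W s)) * x ^ e \<le> c ^ card (W r) * (cmod p powr \<delta>) ^ e"
          using calculation c1 x1 by (intro mult_mono) auto
        ultimately show ?thesis by (simp add: mult_ac)
      next
        case False
        have "c ^ card (W s) \<le> c ^ card (W r)"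
          using c1 Wsub finW by (intro power_increasing card_mono) auto
        moreover have "1 + real e \<le> 2 ^ e"
          using Bernoulli_inequality[of 1 e] by simp
        moreover have "2 = B powr \<delta>" using assms by (simp add: B_def powr_powr)
        moreover have "B powr \<delta> \<le> cmod p powr \<delta>" using False assms
          by (intro powr_mono2) (auto simp: B_def)
        ultimately have "(1 + real e) \<le> (cmod p powr \<delta>) ^ e"
          by (metis order_trans power_mono zero_le_numeral)
        hence "(1 + real e) * c ^ card (W s) \<le> (cmod p powr \<delta>) ^ e * c ^ card (W r)"
          using \<open>c ^ card (W s) \<le> c ^ card (W r)\<close> c1 by (intro mult_mono) auto
        thus ?thesis by (simp add: mult.commute)
      qed
      hence le: "(1 + real e) * c ^ card (W s) * (4 * cmod s powr \<delta>)
          \<le> c ^ card (W r) * (cmod p powr \<delta>) ^ e * (4 * cmod s powr \<delta>)"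
        by (intro mult_right_mono) auto
      have "real (card {t\<in>GI. gdvd t r}) \<le> (1 + real e) * real (card {t\<in>GI. gdvd t s})"
        using card_gdivs_prime_power[OF p(1,2,4) prime s(2) s0 s(3), of e, folded s(1)]
        by (metis Suc_eq_plus1 of_nat_Suc of_nat_le_iff of_nat_mult)
      also have "\<dots> \<le> (1 + real e) * (4 * c ^ card (W s) * cmod s powr \<delta>)"
        using IH by (intro mult_left_mono) auto
      also have "\<dots> \<le> 4 * c ^ card (W r) * cmod r powr \<delta>"
        using le unfolding rnorm by (simp add: mult_ac)
      finally have "real (card {t\<in>GI. gdvd t r}) \<le> 4 * c ^ card (W r) * cmod r powr \<delta>" .
      thus False using not by blast
    qed
  qed
  define C where "C = 4 * c ^ card {w\<in>GI. cmod w \<le> B}"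
  show ?thesis
  proof (rule that[of C])
    show "C > 0" using c1 by (simp add: C_def)
    fix r assume r: "r \<in> GI" "r \<noteq> 0"
    have "card (W r) \<le> card {w\<in>GI. cmod w \<le> B}"
      unfolding W_def by (rule card_mono[OF GI_disc(1)]) auto
    hence "4 * c ^ card (W r) * cmod r powr \<delta> \<le> C * cmod r powr \<delta>"
      unfolding C_def using c1 by (intro mult_right_mono mult_left_mono power_increasing) auto
    thus "real (card {t\<in>GI. gdvd t r}) \<le> C * cmod r powr \<delta>" using key[OF r] by linarith
  qed
qed

section \<open>Diophantine approximation\<close>

text \<open>Pigeonhole: there are \<open>(H + 1)\<^sup>2\<close> multipliers in a square grid but
  only \<open>H\<^sup>2\<close> cells of side \<open>1 / H\<close> for the fractional parts of their
  products with \<open>\<alpha>\<close>. Two multipliers sharing a cell differ by a suitable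
  \<open>r\<close>.\<close>

lemma GI_approx:
  fixes T :: real and \<alpha> :: complex
  assumes "T \<ge> 1"
  obtains r b where "r \<in> GI" "r \<noteq> 0" "b \<in> GI" "cmod r \<le> T" "cmod (r * \<alpha> - b) \<le> 8 / T"
proof (cases "T < 2")
  \<comment> \<open>Below 2 the grid size \<open>H\<close> would be 0, but \<open>8 / T\<close>
    exceeds 1, so rounding \<open>\<alpha>\<close> itself suffices.\<close>
  case True
  obtain g where g: "g \<in> GI" "(cmod (\<alpha> - g))\<^sup>2 \<le> 1 / 2" using GI_round by blast
  hence "(cmod (\<alpha> - g))\<^sup>2 \<le> 1\<^sup>2" by simp
  hence "cmod (\<alpha> - g) \<le> 1" by (rule power2_le_imp_le) simp
  also have "1 \<le> 8 / T" using True assms by simp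
  finally show ?thesis using that[of 1 g] g assms by auto
next
  case False
  \<comment> \<open>The coordinates of a difference are at most \<open>H\<close> in absolute value,
    so its modulus is at most \<open>2 * H \<le> T\<close>. The floor gives
    \<open>T \<le> 4 * H\<close>, which turns the error \<open>2 / H\<close> into
    \<open>8 / T\<close>.\<close>
  define H where "H = nat \<lfloor>T / 2\<rfloor>"
  have H: "1 \<le> H" "2 * real H \<le> T" "T \<le> 4 * real H"
  proof -
    have "1 \<le> \<lfloor>T / 2\<rfloor>" using False by (simp add: le_floor_iff)
    moreover from this have "real H = of_int \<lfloor>T / 2\<rfloor>" by (simp add: H_def)
    ultimately show "1 \<le> H" "2 * real H \<le> T" "T \<le> 4 * real H" by linarith+
  qed
  define w where "w = (\<lambda>(x, y). Complex (real x) (real y))"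
  define f where "f v = (nat \<lfloor>real H * frac (Re (w v * \<alpha>))\<rfloor>, nat \<lfloor>real H * frac (Im (w v * \<alpha>))\<rfloor>)" for v
  have cell: "nat \<lfloor>real H * frac t\<rfloor> < H" for t
  proof -
    have "real H * frac t < real H * 1"
      using H frac_lt_1[of t] by (intro mult_strict_left_mono) auto
    hence "\<lfloor>real H * frac t\<rfloor> < int H" by (simp add: floor_less_iff)
    thus ?thesis using H by linarith
  qed
  have close: "\<bar>frac s - frac t\<bar> \<le> 1 / H" 
    if "nat \<lfloor>real H * frac s\<rfloor> = nat \<lfloor>real H * frac t\<rfloor>" for s t
  proof -
    have "0 \<le> real H * frac s" "0 \<le> real H * frac t" by auto
    hence "0 \<le> \<lfloor>real H * frac s\<rfloor>" "0 \<le> \<lfloor>real H * frac t\<rfloor>" by auto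
    hence "\<lfloor>real H * frac s\<rfloor> = \<lfloor>real H * frac t\<rfloor>" using that by linarith
    hence "\<bar>real H * frac s - real H * frac t\<bar> \<le> 1" by linarith
    hence "real H * \<bar>frac s - frac t\<bar> \<le> 1" by (simp add: abs_mult flip: right_diff_distrib)
    thus ?thesis using H by (simp add: field_simps)
  qed
  have "f ` ({..H} \<times> {..H}) \<subseteq> {..<H} \<times> {..<H}" using cell by (auto simp: f_def)
  hence "card (f ` ({..H} \<times> {..H})) \<le> card ({..<H} \<times> {..<H})" by (intro card_mono) auto
  also have "\<dots> < card ({..H} \<times> {..H})" by (simp add: card_cartesian_product)
  finally have "\<not> inj_on f ({..H} \<times> {..H})" by (rule pigeonhole)
  then obtain u v where uv: "u \<in> {..H} \<times> {..H}" "v \<in> {..H} \<times> {..H}" "u \<noteq> v" "f u = f v"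
    by (auto simp: inj_on_def)
  define r where "r = w u - w v"
  define b where "b = Complex (of_int (\<lfloor>Re (w u * \<alpha>)\<rfloor> - \<lfloor>Re (w v * \<alpha>)\<rfloor>)) (of_int (\<lfloor>Im (w u * \<alpha>)\<rfloor> - \<lfloor>Im (w v * \<alpha>)\<rfloor>))"
  have w_GI: "w v \<in> GI" for v by (auto simp: w_def GI_def split: prod.splits)
  have "r \<noteq> 0" using uv(3) by (auto simp: r_def w_def split: prod.splits)
  moreover have "r \<in> GI" "b \<in> GI" using w_GI unfolding r_def b_def by (simp_all only: GI_diff GI_Complex)
  moreover have "cmod r \<le> T"
  proof -
    have "\<bar>Re r\<bar> \<le> H" "\<bar>Im r\<bar> \<le> H" using uv(1,2) by (auto simp: r_def w_def split: prod.splits)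
    thus ?thesis using cmod_le[of r] H by linarith
  qed
  moreover have "cmod (r * \<alpha> - b) \<le> 8 / T"
  proof -
    have "Re (r * \<alpha> - b) = frac (Re (w u * \<alpha>)) - frac (Re (w v * \<alpha>))"
      "Im (r * \<alpha> - b) = frac (Im (w u * \<alpha>)) - frac (Im (w v * \<alpha>))"
      unfolding r_def b_def by (simp_all add: frac_def algebra_simps)
    hence "\<bar>Re (r * \<alpha> - b)\<bar> \<le> 1 / H" "\<bar>Im (r * \<alpha> - b)\<bar> \<le> 1 / H"
      using uv(4) close by (auto simp: f_def)
    hence "cmod (r * \<alpha> - b) \<le> 2 / H" using cmod_le[of "r * \<alpha> - b"] by linarith
    also have "2 / H \<le> 8 / T" using H False by (simp add: field_simps)
    finally show ?thesis .
  qed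
  ultimately show ?thesis using that by blast
qed

text \<open>Dividing \<open>r\<close> and \<open>b\<close> by their gcd, of modulus at least 1,
  enlarges neither \<open>r\<close> nor the error.\<close>

lemma GI_approx_coprime:
  fixes T :: real and \<alpha> :: complex
  assumes "T \<ge> 1"
  obtains r b where "r \<in> GI" "r \<noteq> 0" "b \<in> GI" "gcoprime b r" "cmod r \<le> T" "cmod (r * \<alpha> - b) \<le> 8 / T"
proof -
  obtain r b where rb: "r \<in> GI" "r \<noteq> 0" "b \<in> GI" "cmod r \<le> T" "cmod (r * \<alpha> - b) \<le> 8 / T"
    using GI_approx[OF assms] by blast
  obtain g x y where g: "g \<in> GI" "g \<noteq> 0" "x \<in> GI" "y \<in> GI" "g = b * x + r * y" "gdvd g b" "gdvd g r"
    using GI_bezout[OF rb(3,1) disjI2[OF rb(2)]] by blast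
  obtain r' b' where *: "r' \<in> GI" "r = g * r'" "b' \<in> GI" "b = g * b'"
    using g(6,7) unfolding gdvd_def by blast
  have g1: "1 \<le> cmod g" using GI_norm_ge_1 g by auto
  have "g * (b' * x + r' * y) = g * 1" using g(5) * by (simp add: algebra_simps)
  hence "b' * x + r' * y = 1" using g(2) by (simp only: mult_cancel_left) simp
  hence "gcoprime b' r'" using gcoprimeI_bezout g by blast
  moreover have "cmod r' \<le> T"
    using mult_right_mono[OF g1, of "cmod r'"] rb(4) * by (simp add: norm_mult)
  moreover have "cmod (r' * \<alpha> - b') \<le> 8 / T"
  proof -
    have "r * \<alpha> - b = g * (r' * \<alpha> - b')" using * by (simp add: algebra_simps)
    hence "cmod g * cmod (r' * \<alpha> - b') \<le> 8 / T" using rb by (simp flip: norm_mult)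
    thus ?thesis using mult_right_mono[OF g1, of "cmod (r' * \<alpha> - b')"] by simp
  qed
  ultimately show ?thesis using that[of r' b'] * rb by auto
qed

section \<open>The large sieve\<close>

lemma ee_add: "ee (x + y) = ee x * ee y"
  by (simp add: ee_def distrib_left exp_add)

lemma ee_eq_cis: "ee x = cis (2 * pi * x)"
  by (simp add: ee_def cis_conv_exp mult_ac)

lemma cnj_ee: "cnj (ee x) = ee (- x)"
  by (simp add: ee_eq_cis cis_cnj)

lemma norm_ee [simp]: "cmod (ee x) = 1"
  by (simp add: ee_eq_cis)

lemma ee_of_nat_mult: "ee (real n * x) = ee x ^ n"
  by (simp add: ee_eq_cis Complex.DeMoivre mult.left_commute)

lemma ee_frac: "ee (frac x) = ee x"
proof -
  have "ee x = ee (frac x) * ee (of_int \<lfloor>x\<rfloor>)"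
    by (simp add: frac_def flip: ee_add)
  also have "ee (of_int \<lfloor>x\<rfloor>) = 1"
    unfolding ee_eq_cis by (rule cis_multiple_2pi) auto
  finally show ?thesis by simp
qed

text \<open>The modulus is \<open>2 * sin (pi * x)\<close>, symmetric about 1/2. On the first half
  the cubic Taylor bound with \<open>pi * y \<le> 16 / 10\<close> gives
  \<open>sin t \<ge> t / 2\<close>; this is weaker than concavity but sufficient.\<close>

lemma norm_one_minus_ee_ge:
  assumes "0 \<le> x" "x \<le> 1"
  shows "2 * min x (1 - x) \<le> cmod (1 - ee x)"
proof -
  have half: "2 * y \<le> 2 * sin (pi * y)" if y: "0 \<le> y" "y \<le> 1 / 2" for y
  proof -
    let ?t = "pi * y"
    have t0: "0 \<le> ?t" using y by simp
    have "pi * y \<le> pi * (1 / 2)" using y by (intro mult_left_mono) auto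
    moreover have "pi \<le> 32 / 10" using pi_approx(2) by simp
    ultimately have "?t \<le> 16 / 10" by linarith
    note t = t0 this
    have "\<bar>sin ?t - ?t\<bar> \<le> ?t ^ 3 / 6"
      using Maclaurin_sin_bound[of ?t 3] t by (simp add: numeral_3_eq_3 sin_coeff_def fact_numeral divide_simps)
    moreover have "?t ^ 3 \<le> ?t * (16 / 10)\<^sup>2"
      using mult_left_mono[OF power_mono[OF t(2,1), of 2] t(1)] by (simp add: power3_eq_cube power2_eq_square mult_ac)
    moreover have "?t * (16 / 10)\<^sup>2 \<le> ?t * 3" using t by (intro mult_left_mono) (auto simp: power2_eq_square)
    ultimately have "?t \<le> 2 * sin ?t" by linarith
    moreover have "2 * y \<le> ?t" using y pi_gt3 by (intro mult_right_mono) auto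
    ultimately show ?thesis by linarith
  qed
  have "cmod (1 - ee x) = 2 * \<bar>sin (pi * x)\<bar>"
    using dist_exp_i_1[of "2 * pi * x"] by (simp add: ee_eq_cis cis_conv_exp norm_minus_commute)
  also have "\<bar>sin (pi * x)\<bar> = sin (pi * x)"
    using assms by (intro abs_of_nonneg sin_ge_zero) (auto simp: mult_le_cancel_left1)
  finally have eq: "cmod (1 - ee x) = 2 * sin (pi * x)" .
  show ?thesis
  proof (cases "x \<le> 1 / 2")
    case True
    thus ?thesis using half[of x] assms unfolding eq by linarith
  next
    case False
    have "sin (pi * (1 - x)) = sin (pi * x)"
      by (simp add: right_diff_distrib sin_diff)
    thus ?thesis using half[of "1 - x"] False assms unfolding eq by linarith
  qed
qed

text \<open>Cell weights of the kernel: \<open>j\<close> is the cell of the torus \<open>\<real>/\<int>\<close>, cut into \<open>M\<close> arcs, that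
  contains the argument, and the two terms measure its distance from \<open>0\<close> on either side.\<close>

definition cellw :: "nat \<Rightarrow> nat \<Rightarrow> real" where
  "cellw M j = 1 / (1 + real j)\<^sup>2 + 1 / (real M - real j)\<^sup>2"

definition dirker :: "nat \<Rightarrow> real \<Rightarrow> complex" where
  "dirker L x = (\<Sum>j<L. ee (real j * x))"

lemma norm_dirker_uminus: "cmod (dirker L (- x)) = cmod (dirker L x)"
proof -
  have "dirker L (- x) = cnj (dirker L x)" by (simp add: dirker_def cnj_ee)
  thus ?thesis by simp
qed

text \<open>Adding the trivial bound \<open>3 * M\<close> to the geometric-series bound yields
  \<open>(1 + d) * cmod S \<le> 4 * M\<close> when the distance to the nearest integer is at least
  \<open>d / M\<close>. The summand 1 keeps this meaningful in the cells next to 0.\<close>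

lemma dirker_bound:
  assumes "M \<ge> 1" and j: "j = nat \<lfloor>real M * frac x\<rfloor>"
  shows "j < M" "(cmod (dirker (3 * M) x))\<^sup>2 \<le> 16 * (real M)\<^sup>2 * cellw M j"
proof -
  let ?f = "frac x" and ?S = "dirker (3 * M) x" and ?L = "3 * M"
  have f: "0 \<le> ?f" "?f < 1" by (auto simp: frac_lt_1)
  have "real M * ?f < real M * 1" using assms f by (intro mult_strict_left_mono) auto
  moreover have jf: "real j = of_int \<lfloor>real M * ?f\<rfloor>" using f by (simp add: j)
  ultimately have j1: "real j \<le> real M * ?f" "real M * ?f < real j + 1" "real j < real M" by linarith+
  show "j < M" using j1 by simp
  have triv: "cmod ?S \<le> 3 * real M"
    unfolding dirker_def by (rule order_trans[OF sum_norm_bound[where K = 1]]) auto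
  have "(1 - ee x) * ?S = 1 - ee x ^ ?L"
    unfolding dirker_def ee_of_nat_mult by (simp only: one_diff_power_eq)
  hence "cmod (1 - ee x) * cmod ?S = cmod (1 - ee x ^ ?L)" by (metis norm_mult)
  also have "\<dots> \<le> 2" by (rule order_trans[OF norm_triangle_ineq4]) (simp add: norm_power)
  finally have "cmod (1 - ee x) * cmod ?S \<le> 2" .
  moreover have "2 * min ?f (1 - ?f) * cmod ?S \<le> cmod (1 - ee x) * cmod ?S"
    using norm_one_minus_ee_ge[of ?f] f by (intro mult_right_mono) (auto simp: ee_frac)
  ultimately have main: "min ?f (1 - ?f) * cmod ?S \<le> 1" by simp
  have gen: "(cmod ?S)\<^sup>2 \<le> 16 * (real M)\<^sup>2 * (1 / (1 + d)\<^sup>2)" if d: "0 \<le> d" "d \<le> real M * min ?f (1 - ?f)" for d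
  proof -
    have "d * cmod ?S \<le> real M * min ?f (1 - ?f) * cmod ?S" using d by (intro mult_right_mono) auto
    also have "\<dots> \<le> real M * 1" unfolding mult.assoc by (intro mult_left_mono main) auto
    finally have "(1 + d) * cmod ?S \<le> 4 * real M" using triv by (simp add: algebra_simps)
    hence "((1 + d) * cmod ?S)\<^sup>2 \<le> (4 * real M)\<^sup>2" using d by (intro power_mono) auto
    hence "(1 + d)\<^sup>2 * (cmod ?S)\<^sup>2 \<le> 16 * (real M)\<^sup>2" by (simp only: power_mult_distrib) simp
    moreover have "0 < (1 + d)\<^sup>2" using d by auto
    ultimately show ?thesis by (simp add: pos_le_divide_eq mult.commute)
  qed
  show "(cmod ?S)\<^sup>2 \<le> 16 * (real M)\<^sup>2 * cellw M j"
  proof (cases "?f \<le> 1 - ?f")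
    case True
    have "(cmod ?S)\<^sup>2 \<le> 16 * (real M)\<^sup>2 * (1 / (1 + real j)\<^sup>2)"
      using True j1 by (intro gen) (auto simp: min_def)
    also have "\<dots> \<le> 16 * (real M)\<^sup>2 * cellw M j" unfolding cellw_def by (intro mult_left_mono) auto
    finally show ?thesis .
  next
    case False
    \<comment> \<open>The cell ends at \<open>(j + 1) / M\<close>, so at least
      \<open>M - j - 1\<close> cells separate it from 1; with the summand 1 this is the
      \<open>M - j\<close> in \<open>cellw\<close>.\<close>
    have "(cmod ?S)\<^sup>2 \<le> 16 * (real M)\<^sup>2 * (1 / (1 + (real M - real j - 1))\<^sup>2)"
      using False j1 \<open>j < M\<close> by (intro gen) (auto simp: min_def algebra_simps)
    also have "\<dots> \<le> 16 * (real M)\<^sup>2 * cellw M j" unfolding cellw_def by (intro mult_left_mono) auto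
    finally show ?thesis .
  qed
qed

lemma cellw_nonneg: "0 \<le> cellw M j"
  by (simp add: cellw_def)

text \<open>The inverse squares telescope to at most 2, and the second half of the weight is the
  first under the reflection of \<open>j\<close> to \<open>M - 1 - j\<close>.\<close>

lemma sum_cellw_le: "(\<Sum>j<M. cellw M j) \<le> 4"
proof -
  have Suc_le: "(\<Sum>j<Suc m. 1 / (1 + real j)\<^sup>2) \<le> 2 - 1 / (1 + real m)" for m
  proof (induction m)
    case (Suc m)
    have "1 / (2 + real m)\<^sup>2 \<le> 1 / ((1 + real m) * (2 + real m))"
      unfolding power2_eq_square by (intro divide_left_mono mult_right_mono) auto
    also have "\<dots> = 1 / (1 + real m) - 1 / (2 + real m)" by (simp add: field_simps)
    finally show ?case using Suc by (simp add: add_ac)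
  qed simp
  have *: "(\<Sum>j<m. 1 / (1 + real j)\<^sup>2) \<le> 2" for m
  proof (cases m)
    case (Suc k)
    have "2 - 1 / (1 + real k) \<le> 2" by simp
    with Suc_le[of k] show ?thesis unfolding Suc by (rule order_trans)
  qed simp
  have "(\<Sum>j<M. 1 / (real M - real j)\<^sup>2) = (\<Sum>j<M. 1 / (1 + real j)\<^sup>2)"
    by (rule sum.reindex_bij_witness[of _ "\<lambda>j. M - Suc j" "\<lambda>j. M - Suc j"]) (auto simp: of_nat_diff)
  thus ?thesis using *[of M] by (simp add: cellw_def sum.distrib)
qed

section \<open>The disc sum as a symmetric kernel form\<close>

lemma mult_le_sum_squares:
  fixes x y :: real
  shows "x * y \<le> (x\<^sup>2 + y\<^sup>2) / 2"
  using sum_squares_ge_zero[of "x - y" 0] by (simp add: power2_eq_square algebra_simps)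

text \<open>Every \<open>n\<close> in the disc is a difference \<open>u - v\<close> of two points of the square of side \<open>3 * M\<close>,
  for each choice of \<open>v\<close> in its middle square of side \<open>M\<close>.\<close>

lemma sum_disc_le_differences:
  fixes g :: "complex \<Rightarrow> real" and M N :: nat
  assumes "\<And>z. 0 \<le> g z" and "sqrt (real N) \<le> real M"
  defines "w \<equiv> (\<lambda>(x, y). Complex (real x) (real y))"
  defines "Bx \<equiv> {..<3 * M} \<times> {..<3 * M}"
  shows "(real M)\<^sup>2 * (\<Sum>n\<in>{n\<in>GI. gnorm n \<le> real N}. g n) \<le> (\<Sum>u\<in>Bx. \<Sum>v\<in>Bx. g (w u - w v))"
proof -
  let ?D = "{n\<in>GI. gnorm n \<le> real N}" and ?C = "{M..<2 * M} \<times> {M..<2 * M}"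
  have fin: "finite Bx" by (simp add: Bx_def)
  have inj: "inj_on (\<lambda>u. w u - w v) Bx" for v
    by (auto simp: inj_on_def w_def)
  have sub: "?D \<subseteq> (\<lambda>u. w u - w v) ` Bx" if v: "v \<in> ?C" for v
  proof
    fix n assume n: "n \<in> ?D"
    then obtain x y where xy: "n = Complex (of_int x) (of_int y)" by (auto elim: GI_E)
    have "cmod n \<le> real M"
      using n assms(2) real_le_rsqrt[of "cmod n" "real N"] by (auto simp: gnorm_eq)
    hence "\<bar>real_of_int x\<bar> \<le> real M" "\<bar>real_of_int y\<bar> \<le> real M"
      using abs_Re_le_cmod[of n] abs_Im_le_cmod[of n] xy by auto
    hence b: "\<bar>x\<bar> \<le> int M" "\<bar>y\<bar> \<le> int M" by linarith+
    obtain v1 v2 where v12: "v = (v1, v2)" by fastforce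
    define u where "u = (nat (x + int v1), nat (y + int v2))"
    have "u \<in> Bx" using b v by (auto simp: Bx_def u_def v12)
    moreover have "0 \<le> x + int v1" "0 \<le> y + int v2" using b v by (auto simp: v12)
    hence "n = w u - w v" by (simp add: xy w_def u_def v12 complex_eq_iff)
    ultimately show "n \<in> (\<lambda>u. w u - w v) ` Bx" by blast
  qed
  have one: "(\<Sum>n\<in>?D. g n) \<le> (\<Sum>u\<in>Bx. g (w u - w v))" if "v \<in> ?C" for v
  proof -
    have "(\<Sum>n\<in>?D. g n) \<le> (\<Sum>n\<in>(\<lambda>u. w u - w v) ` Bx. g n)"
      using sub[OF that] fin assms(1) by (intro sum_mono2) auto
    also have "\<dots> = (\<Sum>u\<in>Bx. g (w u - w v))" by (simp add: sum.reindex[OF inj])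
    finally show ?thesis .
  qed
  have "(real M)\<^sup>2 * (\<Sum>n\<in>?D. g n) = (\<Sum>v\<in>?C. \<Sum>n\<in>?D. g n)"
    by (simp add: card_cartesian_product power2_eq_square)
  also have "\<dots> \<le> (\<Sum>v\<in>?C. \<Sum>u\<in>Bx. g (w u - w v))" by (intro sum_mono one)
  also have "\<dots> \<le> (\<Sum>v\<in>Bx. \<Sum>u\<in>Bx. g (w u - w v))"
    by (intro sum_mono2 fin) (auto simp: Bx_def intro!: sum_nonneg assms(1))
  also have "\<dots> = (\<Sum>u\<in>Bx. \<Sum>v\<in>Bx. g (w u - w v))" by (rule sum.swap)
  finally show ?thesis .
qed

text \<open>With \<open>w u = x + i y\<close> the phase is
  \<open>x * Re \<theta> - y * Im \<theta>\<close>, so the sum separates into two one-dimensional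
  kernels.\<close>

lemma norm_sum_box_ee:
  fixes L :: nat
  defines "w \<equiv> (\<lambda>(x, y). Complex (real x) (real y))"
  shows "cmod (\<Sum>u\<in>{..<L} \<times> {..<L}. ee (Re (w u * \<theta>))) = cmod (dirker L (Re \<theta>)) * cmod (dirker L (Im \<theta>))"
proof -
  have "(\<Sum>u\<in>{..<L} \<times> {..<L}. ee (Re (w u * \<theta>))) = (\<Sum>x<L. \<Sum>y<L. ee (real x * Re \<theta>) * ee (real y * - Im \<theta>))"
    unfolding sum.cartesian_product
    by (intro sum.cong) (auto simp: w_def simp flip: ee_add)
  also have "\<dots> = dirker L (Re \<theta>) * dirker L (- Im \<theta>)"
    unfolding dirker_def by (rule sum_product[symmetric])
  finally show ?thesis by (simp add: norm_mult norm_dirker_uminus)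
qed

text \<open>The phase at a difference \<open>w u - w v\<close> is a factor in \<open>u\<close> times
  the conjugate of the same factor in \<open>v\<close>. Hence the double sum over the box is a
  squared modulus, and the kernel is nonnegative; this is the point of passing to
  differences.\<close>

lemma dual_expansion:
  fixes c \<alpha> :: "'i \<Rightarrow> complex" and w :: "'b \<Rightarrow> complex"
  assumes "finite I" "finite B"
  shows "(\<Sum>u\<in>B. \<Sum>v\<in>B. (cmod (\<Sum>i\<in>I. c i * ee (Re ((w u - w v) * \<alpha> i))))\<^sup>2)
    \<le> (\<Sum>i\<in>I. \<Sum>k\<in>I. cmod (c i) * cmod (c k) * (cmod (\<Sum>u\<in>B. ee (Re (w u * (\<alpha> i - \<alpha> k)))))\<^sup>2)"
proof -
  have e: "ee (Re ((w u - w v) * x)) * cnj (ee (Re ((w u - w v) * y)))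
      = ee (Re (w u * (x - y))) * cnj (ee (Re (w v * (x - y))))" for u v x y
    by (simp add: cnj_ee algebra_simps flip: ee_add)
  have "complex_of_real (\<Sum>u\<in>B. \<Sum>v\<in>B. (cmod (\<Sum>i\<in>I. c i * ee (Re ((w u - w v) * \<alpha> i))))\<^sup>2)
     = (\<Sum>u\<in>B. \<Sum>v\<in>B. (\<Sum>i\<in>I. c i * ee (Re ((w u - w v) * \<alpha> i)))
          * (\<Sum>k\<in>I. cnj (c k) * cnj (ee (Re ((w u - w v) * \<alpha> k)))))"
    by (simp only: of_real_sum complex_norm_square cnj_sum complex_cnj_mult)
  also have "\<dots> = (\<Sum>u\<in>B. \<Sum>v\<in>B. \<Sum>i\<in>I. \<Sum>k\<in>I. c i * cnj (c k) *
      (ee (Re ((w u - w v) * \<alpha> i)) * cnj (ee (Re ((w u - w v) * \<alpha> k)))))"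
    unfolding sum_product by (intro sum.cong refl) (simp add: mult_ac)
  also have "\<dots> = (\<Sum>u\<in>B. \<Sum>i\<in>I. \<Sum>k\<in>I. \<Sum>v\<in>B. c i * cnj (c k) *
      (ee (Re (w u * (\<alpha> i - \<alpha> k))) * cnj (ee (Re (w v * (\<alpha> i - \<alpha> k))))))"
    unfolding e by (intro sum.cong refl, subst sum.swap, intro sum.cong refl, rule sum.swap)
  also have "\<dots> = (\<Sum>i\<in>I. \<Sum>k\<in>I. \<Sum>u\<in>B. \<Sum>v\<in>B. c i * cnj (c k) *
      (ee (Re (w u * (\<alpha> i - \<alpha> k))) * cnj (ee (Re (w v * (\<alpha> i - \<alpha> k))))))"
    by (subst sum.swap, intro sum.cong refl, rule sum.swap)
  also have "\<dots> = (\<Sum>i\<in>I. \<Sum>k\<in>I. c i * cnj (c k) *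
      of_real ((cmod (\<Sum>u\<in>B. ee (Re (w u * (\<alpha> i - \<alpha> k)))))\<^sup>2))"
    unfolding complex_norm_square cnj_sum sum_product by (simp only: sum_distrib_left)
  finally have eq: "complex_of_real (\<Sum>u\<in>B. \<Sum>v\<in>B. (cmod (\<Sum>i\<in>I. c i * ee (Re ((w u - w v) * \<alpha> i))))\<^sup>2) = \<dots>" .
  have "(\<Sum>u\<in>B. \<Sum>v\<in>B. (cmod (\<Sum>i\<in>I. c i * ee (Re ((w u - w v) * \<alpha> i))))\<^sup>2)
    \<le> cmod (complex_of_real (\<Sum>u\<in>B. \<Sum>v\<in>B. (cmod (\<Sum>i\<in>I. c i * ee (Re ((w u - w v) * \<alpha> i))))\<^sup>2))"
    unfolding norm_of_real by (rule abs_ge_self)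
  also have "\<dots> \<le> (\<Sum>i\<in>I. \<Sum>k\<in>I. cmod (c i) * cmod (c k) * (cmod (\<Sum>u\<in>B. ee (Re (w u * (\<alpha> i - \<alpha> k)))))\<^sup>2)"
    unfolding eq
    by (intro sum_norm_le) (simp only: norm_mult norm_of_real complex_mod_cnj abs_power2 order_refl)
  finally show ?thesis .
qed

text \<open>This is Schur's test: \<open>c i * c k\<close> is replaced by the mean of the squares,
  and symmetry reduces both halves to row sums.\<close>

lemma sum_sym_kernel_le:
  fixes G :: "'i \<Rightarrow> 'i \<Rightarrow> real" and c :: "'i \<Rightarrow> real"
  assumes "\<And>i k. 0 \<le> G i k" "\<And>i k. G i k = G k i"
    and "\<And>i. i \<in> I \<Longrightarrow> (\<Sum>k\<in>I. G i k) \<le> B"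
  shows "(\<Sum>i\<in>I. \<Sum>k\<in>I. c i * c k * G i k) \<le> B * (\<Sum>i\<in>I. (c i)\<^sup>2)"
proof -
  have "(\<Sum>i\<in>I. \<Sum>k\<in>I. c i * c k * G i k) \<le> (\<Sum>i\<in>I. \<Sum>k\<in>I. ((c i)\<^sup>2 + (c k)\<^sup>2) / 2 * G i k)"
    by (intro sum_mono mult_right_mono mult_le_sum_squares assms)
  also have "\<dots> = ((\<Sum>i\<in>I. \<Sum>k\<in>I. (c i)\<^sup>2 * G i k) + (\<Sum>i\<in>I. \<Sum>k\<in>I. (c k)\<^sup>2 * G i k)) / 2"
    by (simp add: sum.distrib sum_divide_distrib add_divide_distrib distrib_right)
  also have "(\<Sum>i\<in>I. \<Sum>k\<in>I. (c k)\<^sup>2 * G i k) = (\<Sum>i\<in>I. \<Sum>k\<in>I. (c i)\<^sup>2 * G i k)"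
    by (subst sum.swap) (simp only: assms(2))
  also have "((\<Sum>i\<in>I. \<Sum>k\<in>I. (c i)\<^sup>2 * G i k) + (\<Sum>i\<in>I. \<Sum>k\<in>I. (c i)\<^sup>2 * G i k)) / 2
      = (\<Sum>i\<in>I. (c i)\<^sup>2 * (\<Sum>k\<in>I. G i k))" by (simp only: sum_distrib_left) simp
  also have "\<dots> \<le> (\<Sum>i\<in>I. (c i)\<^sup>2 * B)" by (intro sum_mono mult_left_mono assms) auto
  finally show ?thesis by (simp add: sum_distrib_left mult.commute)
qed

text \<open>The kernel sum is split according to the cell of side \<open>1 / M\<close> containing \<open>\<alpha> i - \<alpha> k\<close> modulo
  \<open>\<int>[\<i>]\<close>; each cell lies in a disc of radius \<open>1 / M\<close>, so it contains at most \<open>K\<close> of the points.\<close>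

lemma kernel_row_sum_le:
  fixes \<alpha> :: "'i \<Rightarrow> complex" and K :: real and M :: nat
  assumes "finite I" "M \<ge> 1"
    and K: "\<And>\<gamma>. real (card {k\<in>I. \<exists>g\<in>GI. cmod (\<alpha> k - \<gamma> - g) \<le> 1 / real M}) \<le> K"
  shows "(\<Sum>k\<in>I. (cmod (dirker (3 * M) (Re (\<alpha>0 - \<alpha> k))) * cmod (dirker (3 * M) (Im (\<alpha>0 - \<alpha> k))))\<^sup>2)
    \<le> 4096 * K * real M ^ 4"
proof -
  define j where "j x = nat \<lfloor>real M * frac x\<rfloor>" for x
  define cell where "cell k = (j (Re (\<alpha>0 - \<alpha> k)), j (Im (\<alpha>0 - \<alpha> k)))" for k
  define W where "W = (\<lambda>(a, b). 256 * real M ^ 4 * (cellw M a * cellw M b))"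
  have jM: "j x < M" for x using dirker_bound(1)[OF assms(2) refl] by (simp add: j_def)
  have term_le: "(cmod (dirker (3 * M) (Re (\<alpha>0 - \<alpha> k))) * cmod (dirker (3 * M) (Im (\<alpha>0 - \<alpha> k))))\<^sup>2 \<le> W (cell k)" for k
  proof -
    have "(cmod (dirker (3 * M) (Re (\<alpha>0 - \<alpha> k))) * cmod (dirker (3 * M) (Im (\<alpha>0 - \<alpha> k))))\<^sup>2
      \<le> (16 * (real M)\<^sup>2 * cellw M (j (Re (\<alpha>0 - \<alpha> k)))) * (16 * (real M)\<^sup>2 * cellw M (j (Im (\<alpha>0 - \<alpha> k))))"
      unfolding power_mult_distrib j_def
      using assms(2) by (intro mult_mono dirker_bound) (auto simp: cellw_nonneg)
    thus ?thesis by (simp add: W_def cell_def power2_eq_square power4_eq_xxxx mult_ac)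
  qed
  have count: "real (card {k\<in>I. cell k = p}) \<le> K" for p
  proof -
    obtain a b where p: "p = (a, b)" by fastforce
    \<comment> \<open>The centre of the cell. Each coordinate is within half a side of it, so the
      sum of the two deviations is at most \<open>1 / M\<close>.\<close>
    define \<kappa> where "\<kappa> = Complex ((real a + 1 / 2) / M) ((real b + 1 / 2) / M)"
    have near: "\<bar>frac x - (real (j x) + 1 / 2) / M\<bar> \<le> 1 / (2 * M)" for x
    proof -
      have "real (j x) = of_int \<lfloor>real M * frac x\<rfloor>" by (simp add: j_def)
      hence "real (j x) \<le> real M * frac x" "real M * frac x \<le> real (j x) + 1" by linarith+
      hence "\<bar>real M * frac x - (real (j x) + 1 / 2)\<bar> \<le> 1 / 2" by linarith
      moreover have "frac x - (real (j x) + 1 / 2) / M = (real M * frac x - (real (j x) + 1 / 2)) / M"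
        using assms(2) by (simp add: field_simps)
      ultimately show ?thesis using assms(2) by (simp add: abs_divide field_simps)
    qed
    have "{k\<in>I. cell k = p} \<subseteq> {k\<in>I. \<exists>g\<in>GI. cmod (\<alpha> k - (\<alpha>0 - \<kappa>) - g) \<le> 1 / real M}"
    proof safe
      fix k assume k: "k \<in> I" "p = cell k"
      define \<theta> where "\<theta> = \<alpha>0 - \<alpha> k"
      define g where "g = - Complex (of_int \<lfloor>Re \<theta>\<rfloor>) (of_int \<lfloor>Im \<theta>\<rfloor>)"
      define z where "z = \<alpha> k - (\<alpha>0 - \<kappa>) - g"
      have ab: "a = j (Re \<theta>)" "b = j (Im \<theta>)" using k p by (auto simp: cell_def \<theta>_def)
      have "Re z = - (frac (Re \<theta>) - (real (j (Re \<theta>)) + 1 / 2) / M)"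
        "Im z = - (frac (Im \<theta>) - (real (j (Im \<theta>)) + 1 / 2) / M)"
        by (simp_all add: z_def g_def \<kappa>_def \<theta>_def frac_def flip: ab)
           (simp_all add: ab \<theta>_def)
      hence "\<bar>Re z\<bar> \<le> 1 / (2 * M)" "\<bar>Im z\<bar> \<le> 1 / (2 * M)"
        using near by (simp_all only: abs_minus_cancel)
      hence "cmod z \<le> 1 / M" using cmod_le[of z] by (simp add: field_simps)
      moreover have "g \<in> GI" unfolding g_def by (simp only: GI_uminus GI_Complex)
      ultimately show "\<exists>g\<in>GI. cmod (\<alpha> k - (\<alpha>0 - \<kappa>) - g) \<le> 1 / real M" unfolding z_def by blast
    qed
    hence "card {k\<in>I. cell k = p} \<le> card {k\<in>I. \<exists>g\<in>GI. cmod (\<alpha> k - (\<alpha>0 - \<kappa>) - g) \<le> 1 / real M}"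
      using assms(1) by (intro card_mono) auto
    thus ?thesis using K[of "\<alpha>0 - \<kappa>"] by linarith
  qed
  have K0: "0 \<le> K" using count[of undefined] by linarith
  have W0: "0 \<le> W p" for p by (auto simp: W_def cellw_nonneg split: prod.splits)
  have "(\<Sum>k\<in>I. (cmod (dirker (3 * M) (Re (\<alpha>0 - \<alpha> k))) * cmod (dirker (3 * M) (Im (\<alpha>0 - \<alpha> k))))\<^sup>2)
      \<le> (\<Sum>k\<in>I. W (cell k))" by (intro sum_mono term_le)
  also have "\<dots> = (\<Sum>p\<in>{..<M} \<times> {..<M}. \<Sum>k\<in>{k\<in>I. cell k = p}. W (cell k))"
    using assms(1) jM by (intro sum.group[symmetric]) (auto simp: cell_def)
  also have "\<dots> = (\<Sum>p\<in>{..<M} \<times> {..<M}. real (card {k\<in>I. cell k = p}) * W p)"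
    by (intro sum.cong) auto
  also have "\<dots> \<le> (\<Sum>p\<in>{..<M} \<times> {..<M}. K * W p)"
    by (intro sum_mono mult_right_mono count W0)
  also have "\<dots> = K * (256 * real M ^ 4 * ((\<Sum>a<M. cellw M a) * (\<Sum>b<M. cellw M b)))"
    unfolding sum_product sum.cartesian_product W_def by (simp add: sum_distrib_left split_def)
  also have "\<dots> \<le> K * (256 * real M ^ 4 * (4 * 4))"
    using K0 by (intro mult_left_mono mult_mono sum_cellw_le sum_nonneg cellw_nonneg) auto
  finally show ?thesis by (simp add: mult_ac)
qed

text \<open>The box majorant gains \<open>M\<^sup>2\<close> on the left and costs
  \<open>M ^ 4\<close> on the right, which leaves a factor \<open>M\<^sup>2\<close> of order
  \<open>N\<close>.\<close>

lemma dual_large_sieve: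
  fixes c \<alpha> :: "'i \<Rightarrow> complex" and K :: real and N :: nat
  assumes "finite I" "N \<ge> 1"
    and K: "\<And>\<gamma>. real (card {k\<in>I. \<exists>g\<in>GI. cmod (\<alpha> k - \<gamma> - g) \<le> 1 / sqrt (real N)}) \<le> K"
  shows "(\<Sum>n\<in>{n\<in>GI. gnorm n \<le> real N}. (cmod (\<Sum>i\<in>I. c i * ee (Re (n * \<alpha> i))))\<^sup>2)
    \<le> 16384 * K * real N * (\<Sum>i\<in>I. (cmod (c i))\<^sup>2)"
proof -
  \<comment> \<open>Rounding up makes the box large enough for the disc of \<open>n\<close> and
    keeps \<open>1 / M\<close> within the radius for which \<open>K\<close> counts. It at most
    doubles \<open>sqrt N\<close>, whence \<open>16384 = 4 * 4096\<close>.\<close>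
  define M where "M = nat \<lceil>sqrt (real N)\<rceil>"
  have sN: "1 \<le> sqrt (real N)" using assms(2) by simp
  hence "1 \<le> \<lceil>sqrt (real N)\<rceil>" by linarith
  hence M: "1 \<le> M" "sqrt (real N) \<le> real M" "real M \<le> 2 * sqrt (real N)"
    using sN unfolding M_def by linarith+
  have K': "real (card {k\<in>I. \<exists>g\<in>GI. cmod (\<alpha> k - \<gamma> - g) \<le> 1 / real M}) \<le> K" for \<gamma>
  proof -
    have "1 / real M \<le> 1 / sqrt (real N)" using M sN by (intro divide_left_mono mult_pos_pos) linarith+
    hence "{k\<in>I. \<exists>g\<in>GI. cmod (\<alpha> k - \<gamma> - g) \<le> 1 / real M}
        \<subseteq> {k\<in>I. \<exists>g\<in>GI. cmod (\<alpha> k - \<gamma> - g) \<le> 1 / sqrt (real N)}" by (auto intro: order_trans)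
    hence "card {k\<in>I. \<exists>g\<in>GI. cmod (\<alpha> k - \<gamma> - g) \<le> 1 / real M}
        \<le> card {k\<in>I. \<exists>g\<in>GI. cmod (\<alpha> k - \<gamma> - g) \<le> 1 / sqrt (real N)}"
      using assms(1) by (intro card_mono) auto
    thus ?thesis using K[of \<gamma>] by linarith
  qed
  have K0: "0 \<le> K" using K[of 0] by linarith
  define w where "w = (\<lambda>(x, y). Complex (real x) (real y))"
  let ?B = "{..<3 * M} \<times> {..<3 * M}" and ?Z = "\<Sum>i\<in>I. (cmod (c i))\<^sup>2"
  define G where "G i k = (cmod (dirker (3 * M) (Re (\<alpha> i - \<alpha> k))) * cmod (dirker (3 * M) (Im (\<alpha> i - \<alpha> k))))\<^sup>2" for i k
  have G_sym: "G i k = G k i" for i k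
  proof -
    have "Re (\<alpha> i - \<alpha> k) = - Re (\<alpha> k - \<alpha> i)" "Im (\<alpha> i - \<alpha> k) = - Im (\<alpha> k - \<alpha> i)" by auto
    thus ?thesis unfolding G_def by (simp only: norm_dirker_uminus)
  qed
  let ?T = "\<Sum>n\<in>{n\<in>GI. gnorm n \<le> real N}. (cmod (\<Sum>i\<in>I. c i * ee (Re (n * \<alpha> i))))\<^sup>2"
  have "(real M)\<^sup>2 * ?T \<le> (\<Sum>u\<in>?B. \<Sum>v\<in>?B. (cmod (\<Sum>i\<in>I. c i * ee (Re ((w u - w v) * \<alpha> i))))\<^sup>2)"
    unfolding w_def by (rule sum_disc_le_differences) (use M in auto)
  also have "\<dots> \<le> (\<Sum>i\<in>I. \<Sum>k\<in>I. cmod (c i) * cmod (c k) * (cmod (\<Sum>u\<in>?B. ee (Re (w u * (\<alpha> i - \<alpha> k)))))\<^sup>2)"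
    by (rule dual_expansion) (use assms in auto)
  also have "\<dots> = (\<Sum>i\<in>I. \<Sum>k\<in>I. cmod (c i) * cmod (c k) * G i k)"
    unfolding w_def norm_sum_box_ee G_def ..
  also have "\<dots> \<le> (4096 * K * real M ^ 4) * ?Z"
  proof (rule sum_sym_kernel_le)
    show "(\<Sum>k\<in>I. G i k) \<le> 4096 * K * real M ^ 4" for i
      unfolding G_def by (rule kernel_row_sum_le[OF assms(1) M(1) K'])
    show "G i k = G k i" for i k by (rule G_sym)
  qed (auto simp: G_def)
  also have "\<dots> = (real M)\<^sup>2 * (4096 * K * (real M)\<^sup>2 * ?Z)"
    by (simp add: power2_eq_square power4_eq_xxxx)
  finally have "?T \<le> 4096 * K * (real M)\<^sup>2 * ?Z"
    using M(1) by (subst (asm) mult_le_cancel_left) auto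
  also have "(real M)\<^sup>2 \<le> 4 * real N"
    using power_mono[OF M(3), of 2] by (simp add: power_mult_distrib)
  hence "4096 * K * (real M)\<^sup>2 * ?Z \<le> 4096 * K * (4 * real N) * ?Z"
    using K0 by (intro mult_right_mono mult_left_mono sum_nonneg) auto
  finally show ?thesis by (simp add: mult_ac)
qed

text \<open>Duality: testing the dual inequality with the coefficients \<open>cnj (F i)\<close> and
  applying Cauchy-Schwarz bounds the square of the left side by itself times the claimed bound, and
  one factor cancels.\<close>

lemma large_sieve:
  fixes a :: "complex \<Rightarrow> complex" and \<alpha> :: "'i \<Rightarrow> complex" and K :: real and N :: nat
  assumes "finite I" "N \<ge> 1"
    and K: "\<And>\<gamma>. real (card {k\<in>I. \<exists>g\<in>GI. cmod (\<alpha> k - \<gamma> - g) \<le> 1 / sqrt (real N)}) \<le> K"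
  shows "(\<Sum>i\<in>I. (cmod (\<Sum>n\<in>{n\<in>GI. gnorm n \<le> real N}. a n * ee (Re (n * \<alpha> i))))\<^sup>2)
    \<le> 16384 * K * real N * (\<Sum>n\<in>{n\<in>GI. gnorm n \<le> real N}. (cmod (a n))\<^sup>2)"
proof -
  let ?D = "{n\<in>GI. gnorm n \<le> real N}"
  define F where "F i = (\<Sum>n\<in>?D. a n * ee (Re (n * \<alpha> i)))" for i
  define H where "H n = (\<Sum>i\<in>I. cnj (F i) * ee (Re (n * \<alpha> i)))" for n
  let ?T = "\<Sum>i\<in>I. (cmod (F i))\<^sup>2" and ?Z = "\<Sum>n\<in>?D. (cmod (a n))\<^sup>2"
  have T0: "0 \<le> ?T" by (intro sum_nonneg) auto
  have K0: "0 \<le> K" using K[of 0] by linarith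
  have mult_F: "x * F i = (\<Sum>n\<in>?D. a n * (x * ee (Re (n * \<alpha> i))))" for x i
    unfolding F_def sum_distrib_left by (intro sum.cong refl) (simp add: mult_ac)
  have "complex_of_real ?T = (\<Sum>i\<in>I. cnj (F i) * F i)" 
    unfolding of_real_sum by (intro sum.cong refl) (subst complex_norm_square, rule mult.commute)
  also have "\<dots> = (\<Sum>i\<in>I. \<Sum>n\<in>?D. a n * (cnj (F i) * ee (Re (n * \<alpha> i))))"
    by (simp only: mult_F)
  also have "\<dots> = (\<Sum>n\<in>?D. a n * H n)" by (subst sum.swap) (simp add: H_def sum_distrib_left)
  finally have "?T = cmod (\<Sum>n\<in>?D. a n * H n)" using T0 by (metis abs_of_nonneg norm_of_real)
  also have "\<dots> \<le> (\<Sum>n\<in>?D. cmod (a n) * cmod (H n))"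
    by (rule sum_norm_le) (simp add: norm_mult)
  finally have "?T\<^sup>2 \<le> (\<Sum>n\<in>?D. cmod (a n) * cmod (H n))\<^sup>2" using T0 by (intro power_mono) auto
  also have "\<dots> \<le> ?Z * (\<Sum>n\<in>?D. (cmod (H n))\<^sup>2)" by (rule Cauchy_Schwarz_ineq_sum)
  also have "\<dots> \<le> ?Z * (16384 * K * real N * (\<Sum>i\<in>I. (cmod (cnj (F i)))\<^sup>2))"
    unfolding H_def by (intro mult_left_mono dual_large_sieve[OF assms] sum_nonneg) auto
  finally have "?T * ?T \<le> (16384 * K * real N * ?Z) * ?T" by (simp add: power2_eq_square mult_ac)
  moreover have "0 \<le> 16384 * K * real N * ?Z" using K0 by (intro mult_nonneg_nonneg sum_nonneg) auto
  ultimately have "?T \<le> 16384 * K * real N * ?Z"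
  proof (cases "?T = 0")
    case False
    hence "0 < ?T" using T0 by linarith
    thus ?thesis using \<open>?T * ?T \<le> _\<close> by (rule mult_right_le_imp_le[rotated])
  qed linarith
  thus ?thesis by (simp add: F_def)
qed

section \<open>Counting fractions near a point\<close>

lemma S_t_card:
  assumes "finite S" "t \<noteq> 0"
  shows "finite (S_t S t)" "card (S_t S t) \<le> card S"
proof -
  have inj: "inj_on ((*) t) (S_t S t)" using assms by (auto simp: inj_on_def)
  have sub: "(*) t ` S_t S t \<subseteq> S" by (auto simp: S_t_def)
  show "finite (S_t S t)" using finite_imageD[OF finite_subset[OF sub assms(1)] inj] .
  show "card (S_t S t) \<le> card S" by (rule card_inj_on_le[OF inj sub assms(1)])
qed

lemma card_le_A_t:
  assumes "finite S" "t \<noteq> 0" "cmod y \<le> sqrt (real Q) / cmod t"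
    and "P \<subseteq> {q \<in> S_t S t \<inter> cball y u. gcong q l k}"
  shows "real (card P) \<le> A_t S Q t u k l"
proof -
  let ?f = "\<lambda>y. real (card {q \<in> S_t S t \<inter> cball y u. gcong q l k})"
  have fin: "finite (S_t S t)" using S_t_card assms by blast
  have "real (card P) \<le> ?f y"
    using assms(4) fin by (intro of_nat_mono card_mono) auto
  also have "\<dots> \<le> A_t S Q t u k l"
    unfolding A_t_def
  proof (rule cSup_upper)
    show "bdd_above (?f ` {y. cmod y \<le> sqrt (real Q) / cmod t})"
      using fin by (intro bdd_aboveI2[where M = "real (card (S_t S t))"] of_nat_mono card_mono) auto
  qed (use assms in auto)
  finally show ?thesis .
qed

text \<open>The supremum in \<open>A_t\<close> admits only centres of modulus at most
  \<open>sqrt Q / cmod t\<close>, and the disc found for \<open>q'\<close> may be centred outside. A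
  point of \<open>P\<close> is always admissible, so a diameter bound suffices; at the largest
  radius the centre 0 works.\<close>

lemma card_small_diameter_le_A_t:
  assumes "finite S" "t \<in> GI" "t \<noteq> 0" "\<And>q. q \<in> S \<Longrightarrow> cmod q \<le> sqrt (real Q)"
    and P: "P \<subseteq> {q \<in> S_t S t. gcong q l k}"
    and u: "u = sqrt (real Q) / cmod t \<or> (\<forall>p\<in>P. \<forall>q\<in>P. cmod (p - q) \<le> u)"
  shows "real (card P) \<le> A_t S Q t u k l"
proof -
  have in_ball: "cmod q \<le> sqrt (real Q) / cmod t" if "q \<in> P" for q
  proof -
    have "cmod (t * q) \<le> sqrt (real Q)" using that P assms(4) by (auto simp: S_t_def)
    thus ?thesis using assms(3) by (simp add: norm_mult field_simps)
  qed
  from u show ?thesis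
  proof
    assume "u = sqrt (real Q) / cmod t"
    thus ?thesis using P in_ball assms
      by (intro card_le_A_t[where y = 0]) auto
  next
    assume diam: "\<forall>p\<in>P. \<forall>q\<in>P. cmod (p - q) \<le> u"
    show ?thesis
    proof (cases "P = {}")
      case True
      thus ?thesis using assms by (intro card_le_A_t[where y = 0]) auto
    next
      case False
      then obtain y where "y \<in> P" by blast
      thus ?thesis using P in_ball diam assms
        by (intro card_le_A_t[where y = y]) (auto simp: dist_norm)
    qed
  qed
qed

lemma card_le_mult_fibres:
  fixes c :: real
  assumes "finite P" "finite Y" "f ` P \<subseteq> Y" "\<And>y. y \<in> Y \<Longrightarrow> real (card {p\<in>P. f p = y}) \<le> c"
  shows "real (card P) \<le> real (card Y) * c"
proof -
  have "real (card P) = (\<Sum>p\<in>P. 1)" by simp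
  also have "\<dots> = (\<Sum>y\<in>Y. \<Sum>p\<in>{p\<in>P. f p = y}. 1)" by (rule sum.group[symmetric]) (use assms in auto)
  also have "\<dots> \<le> (\<Sum>y\<in>Y. c)" using assms(4) by (intro sum_mono) simp
  finally show ?thesis by simp
qed

text \<open>Pairs rather than quotients are recorded, since associate denominators in
  \<open>S\<close> give the same fraction with separate summands. Numerators are not reduced modulo
  \<open>q\<close>, so nearness is in the plane and not on the torus.\<close>

definition near_pairs :: "complex set \<Rightarrow> real \<Rightarrow> complex \<Rightarrow> (complex \<times> complex) set" where
  "near_pairs S d \<gamma> = {(q, a). q \<in> S \<and> a \<in> GI \<and> gcoprime a q \<and> cmod (a / q - \<gamma>) \<le> d}"

lemma near_pairs_finite:
  assumes "finite S" "0 \<notin> S"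
  shows "finite (near_pairs S d \<gamma>)"
proof -
  have "near_pairs S d \<gamma> \<subseteq> Sigma S (\<lambda>q. {a\<in>GI. cmod a \<le> cmod q * (d + cmod \<gamma>)})"
  proof (clarsimp simp: near_pairs_def)
    fix q a assume *: "q \<in> S" "cmod (a / q - \<gamma>) \<le> d"
    have "cmod (a / q) \<le> d + cmod \<gamma>" using *(2) norm_triangle_ineq2[of "a / q" \<gamma>] by linarith
    thus "cmod a \<le> cmod q * (d + cmod \<gamma>)"
      using * assms by (auto simp: norm_divide divide_le_eq mult.commute split: if_splits)
  qed
  thus ?thesis by (rule finite_subset) (intro finite_SigmaI assms GI_disc)
qed

text \<open>The radius \<open>u\<close> used for the divisor \<open>t\<close>;
  \<open>s\<close>, \<open>\<tau>\<close>, \<open>\<kappa>\<close>, \<open>\<zeta>\<close> stand for \<open>sqrt Q\<close>, \<open>\<bar>t\<bar>\<close>, \<open>\<bar>k\<bar>\<close> and \<open>\<bar>\<gamma> - b / r\<bar>\<close>.\<close>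

lemma radius_choice:
  fixes T s \<tau> \<kappa> \<zeta> :: real
  assumes "1 \<le> T" "0 \<le> s" "1 \<le> \<tau>" "0 < \<kappa>" "0 \<le> \<zeta>" "\<tau> * \<kappa> \<le> T" "\<tau> * \<kappa> * \<zeta> \<le> 8 / T"
  obtains u where "\<kappa> * s / (2 * T) \<le> u" "u \<le> s / \<tau>"
    "u = s / \<tau> \<or> (0 < \<zeta> \<and> 2 * s / (T\<^sup>2 * \<tau> * \<zeta>) \<le> u)"
    "0 \<le> u" "(\<zeta> + 1 / T\<^sup>2) * (u * \<tau>) \<le> 7 * s / T\<^sup>2"
proof -
  define lb where "lb = \<kappa> * s / (2 * T)"
  \<comment> \<open>\<open>u0\<close> is the diameter of the possible \<open>q'\<close> for one
    \<open>m\<close>, and \<open>lb\<close> the lower end of the admissible radii. Division by zero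
    would make \<open>u0\<close> vanish at \<open>\<zeta> = 0\<close>, where \<open>m\<close> does
    not confine \<open>q'\<close> at all; hence the separate case in \<open>u\<close>.\<close>
  define u0 where "u0 = 2 * s / (T\<^sup>2 * \<tau> * \<zeta>)"
  define u where "u = (if \<zeta> = 0 then s / \<tau> else min (s / \<tau>) (max u0 lb))"
  have lb0: "0 \<le> lb" using assms by (simp add: lb_def)
  have u0_nn: "0 \<le> u0" using assms by (simp add: u0_def)
  have "\<tau> * \<kappa> * s \<le> (2 * T) * s" using assms by (intro mult_right_mono) auto
  hence lb: "lb \<le> s / \<tau>" using assms by (simp add: lb_def field_simps)
  have u: "lb \<le> u" "u \<le> s / \<tau>" using lb by (auto simp: u_def)
  have "\<zeta> * (u * \<tau>) \<le> 6 * s / T\<^sup>2"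
  proof (cases "\<zeta> = 0")
    case False
    \<comment> \<open>Bounding the maximum by the sum, \<open>u0\<close> contributes 2 and
      \<open>lb\<close> contributes 4 to the constant 6; the summand \<open>1 / T\<^sup>2\<close>
      raises it to 7.\<close>
    have "u \<le> u0 + lb" using False lb0 u0_nn by (auto simp: u_def)
    hence "\<zeta> * (u * \<tau>) \<le> \<zeta> * ((u0 + lb) * \<tau>)" using assms by (intro mult_left_mono mult_right_mono) auto
    also have "\<dots> = 2 * s / T\<^sup>2 + \<tau> * \<kappa> * \<zeta> * (s / (2 * T))"
      using False assms by (simp add: u0_def lb_def field_simps)
    also have "\<tau> * \<kappa> * \<zeta> * (s / (2 * T)) \<le> 8 / T * (s / (2 * T))"
      using assms by (intro mult_right_mono) auto
    also have "2 * s / T\<^sup>2 + 8 / T * (s / (2 * T)) = 6 * s / T\<^sup>2"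
      using assms by (simp add: field_simps power2_eq_square)
    finally show ?thesis by simp
  qed (use assms in auto)
  moreover have "1 / T\<^sup>2 * (u * \<tau>) \<le> 1 / T\<^sup>2 * s"
    using u(2) assms by (intro mult_left_mono) (auto simp: field_simps)
  ultimately have "(\<zeta> + 1 / T\<^sup>2) * (u * \<tau>) \<le> 6 * s / T\<^sup>2 + s / T\<^sup>2" by (simp add: distrib_right)
  hence "(\<zeta> + 1 / T\<^sup>2) * (u * \<tau>) \<le> 7 * s / T\<^sup>2" by (simp add: field_simps)
  moreover have "u = s / \<tau> \<or> (0 < \<zeta> \<and> u0 \<le> u)" using assms(5) by (auto simp: u_def)
  ultimately show ?thesis using that[of u] u lb0 by (auto simp: lb_def u0_def)
qed

text \<open>\<open>P\<close> consists of pairs with \<open>gcd (a * r - b * q) r = t\<close>, where \<open>r = t * k\<close>.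
  Writing \<open>a * r - b * q = t * m\<close> and \<open>q = t * q'\<close>,
  the value \<open>m\<close> fixes \<open>q'\<close> modulo \<open>k\<close> and confines it to a disc.\<close>

lemma card_pairs_gcd_le:
  fixes Q :: nat and T X :: real
  assumes T: "T \<ge> 1" and Q: "Q \<ge> 1" and S: "S \<subseteq> GI - {0}" "\<And>q. q \<in> S \<Longrightarrow> cmod q \<le> sqrt (real Q)"
    and finS: "finite S" and X: "X \<ge> 0"
    and t: "t \<in> GI" "t \<noteq> 0" and k: "k \<in> GI" "k \<noteq> 0" and tk: "cmod (t * k) \<le> T"
    and b: "b \<in> GI" "gcoprime b (t * k)" and approx: "cmod (t * k * \<gamma> - b) \<le> 8 / T"
    and hyp: "\<And>l u. l \<in> GI \<Longrightarrow> gcoprime k l \<Longrightarrow> cmod k * sqrt (real Q) / (2 * T) \<le> u \<Longrightarrow>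
      u \<le> sqrt (real Q) / cmod t \<Longrightarrow>
      A_t S Q t u k l \<le> (1 + (real (card (S_t S t)) / gnorm k) / (real Q / (cmod t)\<^sup>2) * u\<^sup>2) * X"
    and P: "P \<subseteq> near_pairs S (1 / T\<^sup>2) \<gamma>"
      "\<And>q a. (q, a) \<in> P \<Longrightarrow> \<exists>m q'. m \<in> GI \<and> m \<noteq> 0 \<and> q' \<in> GI \<and> gcoprime m k \<and> a * (t * k) - b * q = t * m \<and> q = t * q'"
  shows "real (card P) \<le> 729 * real Q * X * (1 / T\<^sup>2 + real (card S) / T ^ 4)"
proof -
  define s where "s = sqrt (real Q)"
  define \<tau> where "\<tau> = cmod t"
  define \<kappa> where "\<kappa> = cmod k"
  define z where "z = t * k * \<gamma> - b"
  define \<zeta> where "\<zeta> = cmod z / (\<tau> * \<kappa>)"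
  define \<sigma> where "\<sigma> = real (card (S_t S t))"
  \<comment> \<open>The range of \<open>m\<close>: it lies within
    \<open>\<kappa> * s / T\<^sup>2\<close> of \<open>q' * z\<close>, whose modulus is at most
    \<open>(s / \<tau>) * (\<tau> * \<kappa> * \<zeta>)\<close>.\<close>
  define \<rho> where "\<rho> = s * \<kappa> * (\<zeta> + 1 / T\<^sup>2)"
  have s: "1 \<le> s" "s\<^sup>2 = real Q" using Q by (auto simp: s_def)
  have \<tau>: "1 \<le> \<tau>" and \<kappa>: "1 \<le> \<kappa>" unfolding \<tau>_def \<kappa>_def using GI_norm_ge_1 t k by auto
  have \<tau>\<kappa>: "\<tau> * \<kappa> \<le> T" using tk by (simp add: norm_mult \<tau>_def \<kappa>_def)
  have z: "cmod z = \<tau> * \<kappa> * \<zeta>" using \<tau> \<kappa> by (simp add: \<zeta>_def)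
  have \<zeta>: "0 \<le> \<zeta>" "\<tau> * \<kappa> * \<zeta> \<le> 8 / T" using \<tau> \<kappa> approx by (auto simp: \<zeta>_def z_def)
  have \<sigma>: "0 \<le> \<sigma>" "\<sigma> \<le> real (card S)" using S_t_card finS t by (auto simp: \<sigma>_def)
  obtain u where u: "\<kappa> * s / (2 * T) \<le> u" "u \<le> s / \<tau>"
    "u = s / \<tau> \<or> (0 < \<zeta> \<and> 2 * s / (T\<^sup>2 * \<tau> * \<zeta>) \<le> u)"
    "0 \<le> u" "(\<zeta> + 1 / T\<^sup>2) * (u * \<tau>) \<le> 7 * s / T\<^sup>2"
    using radius_choice[of T s \<tau> \<kappa> \<zeta>] T s \<tau> \<kappa> \<tau>\<kappa> \<zeta> by auto
  \<comment> \<open>Here \<open>x\<close> inverts \<open>b\<close> modulo \<open>k\<close>, so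
    \<open>m = a * k - b * q'\<close> puts \<open>q'\<close> into the class of
    \<open>- (x * m)\<close>. The next step multiplies two Bezout identities to see that this class
    is coprime to \<open>k\<close>.\<close>
  obtain x y where xy: "x \<in> GI" "y \<in> GI" "b * x + t * k * y = 1"
    using gcoprime_bezout[OF b(2)] b t k by auto
  have cop: "gcoprime k (- (x * m))" if m: "m \<in> GI" "gcoprime m k" for m
  proof -
    obtain c d where cd: "c \<in> GI" "d \<in> GI" "m * c + k * d = 1"
      using gcoprime_bezout[OF m(2,1) k(1)] by blast
    have "k * (d * (b * x + t * k * y) + m * c * t * y) + - (x * m) * (- (c * b))
        = (m * c + k * d) * (b * x + t * k * y)" by (simp add: algebra_simps)
    also have "\<dots> = 1" using cd xy by simp
    finally show ?thesis
      by (rule gcoprimeI_bezout) (use cd xy b t k m in auto)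
  qed
  have "0 \<notin> S" using S by auto
  hence finP: "finite P" using finite_subset[OF P(1)] near_pairs_finite finS by blast
  define f where "f = (\<lambda>(q, a). (a * (t * k) - b * q) / t)"
  have Pf: "f (q, a) = a * k - b * q'" "q' \<in> S_t S t" "cmod q' * \<tau> \<le> s"
    "cmod (f (q, a) - q' * z) \<le> \<kappa> * s / T\<^sup>2" if "(q, a) \<in> P" "q = t * q'" "q' \<in> GI" for q a q'
  proof -
    show f: "f (q, a) = a * k - b * q'" using that t by (simp add: f_def field_simps)
    have q: "q \<in> S" "cmod (a / q - \<gamma>) \<le> 1 / T\<^sup>2" "q \<noteq> 0" using that(1) P(1) S by (auto simp: near_pairs_def)
    show "q' \<in> S_t S t" using q that by (simp add: S_t_def)
    show "cmod q' * \<tau> \<le> s" using S(2)[OF q(1)] that by (simp add: norm_mult \<tau>_def s_def mult.commute)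
    \<comment> \<open>The term \<open>b * q'\<close> cancels, leaving only the distance of
      \<open>a / q\<close> from \<open>\<gamma>\<close>, scaled by \<open>k * q\<close>.\<close>
    have "f (q, a) - q' * z = k * q * (a / q - \<gamma>)"
      unfolding f z_def using that q(3) by (simp add: field_simps)
    hence "cmod (f (q, a) - q' * z) = \<kappa> * cmod q * cmod (a / q - \<gamma>)" by (simp add: norm_mult \<kappa>_def)
    also have "\<dots> \<le> \<kappa> * s * (1 / T\<^sup>2)"
      using q S(2)[OF q(1)] \<kappa> s by (intro mult_mono) (auto simp: s_def)
    finally show "cmod (f (q, a) - q' * z) \<le> \<kappa> * s / T\<^sup>2" by simp
  qed
  have fY: "f ` P \<subseteq> {m\<in>GI. m \<noteq> 0 \<and> cmod m \<le> \<rho>}"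
  proof safe
    fix q a assume qa: "(q, a) \<in> P"
    obtain m q' where m: "m \<in> GI" "m \<noteq> 0" "q' \<in> GI" "a * (t * k) - b * q = t * m" "q = t * q'"
      using P(2)[OF qa] by blast
    have fm: "f (q, a) = m" using m t by (simp add: f_def)
    thus "f (q, a) \<in> GI" "f (q, a) = 0 \<Longrightarrow> False" using m by auto
    have "cmod (f (q, a)) \<le> cmod (q' * z) + \<kappa> * s / T\<^sup>2"
      using norm_triangle_ineq2[of "f (q, a)" "q' * z"] Pf(4)[OF qa m(5,3)] by linarith
    also have "cmod (q' * z) = (cmod q' * \<tau>) * (\<kappa> * \<zeta>)" by (simp add: norm_mult z)
    also have "\<dots> \<le> s * (\<kappa> * \<zeta>)" using Pf(3)[OF qa m(5,3)] \<kappa> \<zeta> by (intro mult_right_mono) auto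
    finally show "cmod (f (q, a)) \<le> \<rho>" by (simp add: \<rho>_def algebra_simps)
  qed
  define F where "F = (1 + (\<sigma> / \<kappa>\<^sup>2) / (real Q / \<tau>\<^sup>2) * u\<^sup>2) * X"
  have F0: "0 \<le> F" using X \<sigma> by (simp add: F_def)
  have fibre: "real (card {p\<in>P. f p = m}) \<le> F" if "m \<in> {m\<in>GI. m \<noteq> 0 \<and> cmod m \<le> \<rho>}" for m
  proof (cases "{p\<in>P. f p = m} = {}")
    case True
    thus ?thesis using F0 by (simp only: card.empty)
  next
    case False
    let ?Pm = "{p\<in>P. f p = m}" and ?g = "\<lambda>(q, a). q / t"
    obtain q1 a1 where qa1: "(q1, a1) \<in> P" "f (q1, a1) = m" using False by auto
    have mc: "m \<in> GI" "gcoprime m k"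
      using P(2)[OF qa1(1)] qa1(2) t by (auto simp: f_def)
    have r: "t * k \<noteq> 0" using t k by simp
    have "inj_on ?g ?Pm"
    proof (rule inj_onI, clarify)
      fix q a q0 a0 assume *: "(q, a) \<in> P" "(q0, a0) \<in> P" "m = f (q, a)" "f (q0, a0) = f (q, a)" "q / t = q0 / t"
      have "q = q0" using * t by simp
      moreover from this have "a = a0" using * t r by (simp add: f_def)
      ultimately show "q = q0 \<and> a = a0" by simp
    qed
    hence "card ?Pm = card (?g ` ?Pm)" by (simp add: card_image)
    also have "real (card (?g ` ?Pm)) \<le> A_t S Q t u k (- (x * m))"
    proof (rule card_small_diameter_le_A_t[OF finS t S(2)])
      show "?g ` ?Pm \<subseteq> {q \<in> S_t S t. gcong q (- (x * m)) k}"
      proof clarify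
        fix q a assume qa: "(q, a) \<in> P" "m = f (q, a)"
        obtain q' where q': "q' \<in> GI" "q = t * q'" using P(2)[OF qa(1)] by blast
        have a: "a \<in> GI" using P(1) qa by (auto simp: near_pairs_def)
        have "q' - - (x * f (q, a)) = q' * (1 - b * x) + x * a * k"
          unfolding Pf(1)[OF qa(1) q'(2,1)] by (simp add: algebra_simps)
        also have "1 - b * x = t * k * y" using xy by (simp add: algebra_simps)
        also have "q' * (t * k * y) + x * a * k = k * (q' * t * y + x * a)" by (simp add: algebra_simps)
        finally have "gcong q' (- (x * f (q, a))) k"
          unfolding gcong_def using q' t xy a by (simp del: diff_minus_eq_add)
        moreover have "q / t = q'" using q' t by simp
        ultimately show "q / t \<in> S_t S t \<and> gcong (q / t) (- (x * f (q, a))) k"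
          using Pf(2)[OF qa(1) q'(2,1)] by simp
      qed
      show "u = sqrt (real Q) / cmod t \<or> (\<forall>p\<in>?g ` ?Pm. \<forall>q\<in>?g ` ?Pm. cmod (p - q) \<le> u)"
      proof (cases "u = s / \<tau>")
        case False
        hence u': "0 < \<zeta>" "2 * s / (T\<^sup>2 * \<tau> * \<zeta>) \<le> u" using u by auto
        have "cmod (p - q) \<le> u" if pq: "p \<in> ?g ` ?Pm" "q \<in> ?g ` ?Pm" for p q
        proof -
          have *: "cmod (m - v * z) \<le> \<kappa> * s / T\<^sup>2" if v: "v \<in> ?g ` ?Pm" for v
          proof -
            obtain q a where qa: "(q, a) \<in> P" "m = f (q, a)" "v = q / t" using v by auto
            obtain q' where q': "q' \<in> GI" "q = t * q'" using P(2)[OF qa(1)] by blast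
            have "v = q'" using q' qa t by simp
            thus ?thesis using Pf(4)[OF qa(1) q'(2,1)] qa by simp
          qed
          have "cmod ((p - q) * z) = cmod ((m - q * z) - (m - p * z))" by (simp add: algebra_simps)
          also have "\<dots> \<le> 2 * (\<kappa> * s / T\<^sup>2)"
            using norm_triangle_ineq4[of "m - q * z" "m - p * z"] *[OF pq(1)] *[OF pq(2)] by linarith
          finally have "\<kappa> * (cmod (p - q) * (\<tau> * \<zeta>)) \<le> \<kappa> * (2 * s / T\<^sup>2)"
            by (simp add: norm_mult z mult_ac)
          hence "cmod (p - q) * (\<tau> * \<zeta>) \<le> 2 * s / T\<^sup>2" using \<kappa> by (subst (asm) mult_le_cancel_left) auto
          moreover have "0 < \<tau> * \<zeta>" using \<tau> u' by simp
          ultimately have "cmod (p - q) \<le> 2 * s / T\<^sup>2 / (\<tau> * \<zeta>)" by (simp only: pos_le_divide_eq)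
          also have "\<dots> = 2 * s / (T\<^sup>2 * \<tau> * \<zeta>)" by (simp add: mult_ac)
          finally show ?thesis using u' by linarith
        qed
        thus ?thesis by blast
      qed (simp add: s_def \<tau>_def)
    qed
    also have "\<dots> \<le> F"
      using hyp[OF _ cop[OF mc], of u] mc xy u(1,2)
      by (simp add: F_def \<sigma>_def \<kappa>_def \<tau>_def s_def gnorm_eq)
    finally show ?thesis .
  qed
  have "real (card P) \<le> real (card {m\<in>GI. m \<noteq> 0 \<and> cmod m \<le> \<rho>}) * F"
    by (rule card_le_mult_fibres[OF finP _ fY fibre]) (rule finite_subset[OF _ GI_disc(1)[of \<rho>]], auto)
  also have "\<dots> \<le> 9 * \<rho>\<^sup>2 * F" using F0 GI_disc(2) by (intro mult_right_mono)
  \<comment> \<open>In the second product \<open>Q\<close> and \<open>\<kappa>\<^sup>2\<close>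
    cancel and \<open>\<tau>\<close> joins \<open>u\<close>, which is the combination that the
    choice of \<open>u\<close> controls.\<close>
  also have "\<dots> = 9 * real Q * X * (\<kappa> * (\<zeta> + 1 / T\<^sup>2))\<^sup>2 + 9 * X * \<sigma> * ((\<zeta> + 1 / T\<^sup>2) * (u * \<tau>))\<^sup>2"
    using Q \<tau> \<kappa> unfolding \<rho>_def F_def power_mult_distrib s(2) by (simp add: field_simps)
  also have "\<dots> \<le> 9 * real Q * X * (9 / T)\<^sup>2 + 9 * X * real (card S) * (7 * s / T\<^sup>2)\<^sup>2"
  proof -
    \<comment> \<open>Uniformity in \<open>t\<close> for the first term:
      \<open>\<tau> * \<kappa>\<close> is bounded as a whole, giving \<open>9 = 8 + 1\<close>, and
      \<open>\<tau> \<ge> 1\<close> is then dropped. The squares produce \<open>729 = 9 * 81\<close>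
      and \<open>441 = 9 * 49\<close>.\<close>
    have "\<tau> * (\<kappa> * (\<zeta> + 1 / T\<^sup>2)) = \<tau> * \<kappa> * \<zeta> + \<tau> * \<kappa> * (1 / T\<^sup>2)" by (simp add: algebra_simps)
    also have "\<dots> \<le> 8 / T + T * (1 / T\<^sup>2)" using \<zeta>(2) \<tau>\<kappa> by (intro add_mono mult_right_mono) auto
    also have "\<dots> = 9 / T" using T by (simp add: field_simps power2_eq_square)
    finally have "\<tau> * (\<kappa> * (\<zeta> + 1 / T\<^sup>2)) \<le> 9 / T" .
    moreover have "1 * (\<kappa> * (\<zeta> + 1 / T\<^sup>2)) \<le> \<tau> * (\<kappa> * (\<zeta> + 1 / T\<^sup>2))"
      using \<tau> \<kappa> \<zeta> by (intro mult_right_mono) auto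
    ultimately have "\<kappa> * (\<zeta> + 1 / T\<^sup>2) \<le> 9 / T" by simp
    thus ?thesis using X \<sigma> u \<tau> \<kappa> \<zeta>
      by (intro add_mono mult_mono mult_left_mono power_mono mult_nonneg_nonneg) auto
  qed
  also have "\<dots> = 729 * real Q * X / T\<^sup>2 + 441 * real Q * X * real (card S) / T ^ 4"
    by (simp add: power_divide power_mult_distrib s(2) mult_ac flip: power_mult)
  also have "\<dots> \<le> 729 * real Q * X / T\<^sup>2 + 729 * real Q * X * real (card S) / T ^ 4"
    using X T by (intro add_mono divide_right_mono mult_right_mono order_refl) auto
  finally show ?thesis by (simp add: algebra_simps)
qed

text \<open>Since \<open>b / r\<close> is reduced, \<open>q = r * v\<close> and
  \<open>a = b * v\<close>; as \<open>v\<close> divides both, it is one of the four units, and it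
  determines the pair.\<close>

lemma card_pairs_eq_fraction_le:
  assumes "r \<in> GI" "r \<noteq> 0" "b \<in> GI" "gcoprime b r"
    and P: "\<And>q a. (q, a) \<in> P \<Longrightarrow> q \<in> GI \<and> q \<noteq> 0 \<and> a \<in> GI \<and> gcoprime a q \<and> a * r = b * q"
  shows "card P \<le> 4"
proof -
  have "card P \<le> card {1, -1, \<i>, -\<i>}"
  proof (rule card_inj_on_le[where f = "\<lambda>(q, a). q / r"])
    show "inj_on (\<lambda>(q, a). q / r) P"
    proof (rule inj_onI, clarify)
      fix q a q0 a0 assume *: "(q, a) \<in> P" "(q0, a0) \<in> P" "q / r = q0 / r"
      have "q = q0" using * assms by simp
      moreover from this have "a * r = a0 * r" using P[OF *(1)] P[OF *(2)] by simp
      ultimately show "q = q0 \<and> a = a0" using assms by simp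
    qed
    show "(\<lambda>(q, a). q / r) ` P \<subseteq> {1, -1, \<i>, -\<i>}"
    proof
      fix w assume "w \<in> (\<lambda>(q, a). q / r) ` P"
      then obtain q a where w: "w = q / r" and "(q, a) \<in> P" by auto
      hence qa: "q \<in> GI" "q \<noteq> 0" "a \<in> GI" "gcoprime a q" "a * r = b * q" using P by auto
      have "gdvd r (b * q)" using qa assms by (metis gdvd_mult2 gdvd_refl)
      hence "gdvd r q" using gcoprime_gdvd_mult assms qa by blast
      then obtain v where v: "v \<in> GI" "q = r * v" by (auto simp: gdvd_def)
      have "a = b * v" using qa(5) v assms by simp
      hence "gunit v" using qa v assms by (metis gcoprime_def gdvd_mult2 gdvd_refl)
      hence "v \<in> {1, -1, \<i>, -\<i>}" by (simp only: gunit_iff)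
      moreover have "w = v" using w v assms by simp
      ultimately show "w \<in> {1, -1, \<i>, -\<i>}" by simp
    qed
  qed auto
  also have "\<dots> \<le> 4" by (simp add: card_insert_if)
  finally show ?thesis .
qed

lemma card_near_pairs_le:
  fixes Q :: nat and T X D :: real
  assumes T: "T \<ge> 1" and Q: "Q \<ge> 1" and S: "S \<subseteq> GI - {0}" "\<And>q. q \<in> S \<Longrightarrow> cmod q \<le> sqrt (real Q)"
    and X: "X \<ge> 0"
    and hyp: "\<And>t k l u. t \<in> GI - {0} \<Longrightarrow> cmod t \<le> T \<Longrightarrow> k \<in> GI - {0} \<Longrightarrow> cmod k \<le> T / cmod t \<Longrightarrow>
      l \<in> GI \<Longrightarrow> gcoprime k l \<Longrightarrow> cmod k * sqrt (real Q) / (2 * T) \<le> u \<Longrightarrow>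
      u \<le> sqrt (real Q) / cmod t \<Longrightarrow>
      A_t S Q t u k l \<le> (1 + (real (card (S_t S t)) / gnorm k) / (real Q / (cmod t)\<^sup>2) * u\<^sup>2) * X"
    and D: "\<And>r. r \<in> GI \<Longrightarrow> r \<noteq> 0 \<Longrightarrow> cmod r \<le> T \<Longrightarrow> real (card {t\<in>GI. gdvd t r}) \<le> D"
  shows "real (card (near_pairs S (1 / T\<^sup>2) \<gamma>)) \<le> 4 + D * (729 * real Q * X * (1 / T\<^sup>2 + real (card S) / T ^ 4))"
proof -
  let ?P = "near_pairs S (1 / T\<^sup>2) \<gamma>" and ?B = "729 * real Q * X * (1 / T\<^sup>2 + real (card S) / T ^ 4)"
  have finS: "finite S"
    by (rule finite_subset[OF _ GI_disc(1)[of "sqrt (real Q)"]]) (use S in auto)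
  have finP: "finite ?P" using near_pairs_finite finS S by blast
  obtain r b where r: "r \<in> GI" "r \<noteq> 0" "cmod r \<le> T" and b: "b \<in> GI" "gcoprime b r"
    and approx: "cmod (r * \<gamma> - b) \<le> 8 / T"
    using GI_approx_coprime[OF T, of \<gamma>] by metis
  define P0 where "P0 = {(q, a)\<in>?P. a * r = b * q}"
  define Pt where "Pt t = {(q, a)\<in>?P. \<exists>k m q'. r = t * k \<and> m \<in> GI \<and> m \<noteq> 0 \<and> q' \<in> GI \<and> gcoprime m k
      \<and> a * r - b * q = t * m \<and> q = t * q'}" for t
  have "card P0 \<le> 4"
    by (rule card_pairs_eq_fraction_le[OF r(1,2) b]) (use S in \<open>auto simp: P0_def near_pairs_def\<close>)
  have Pt: "real (card (Pt t)) \<le> ?B" if "t \<in> {t\<in>GI. gdvd t r}" for t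
  proof -
    from that obtain k where k: "t \<in> GI" "k \<in> GI" "r = t * k" by (auto simp: gdvd_def)
    have tk0: "t \<noteq> 0" "k \<noteq> 0" using r k by auto
    have "cmod t \<le> T" using that r gdvd_norm_le by fastforce
    moreover have "cmod k \<le> T / cmod t" using r(3) k tk0 by (simp add: norm_mult field_simps)
    ultimately show ?thesis
      using k tk0 r b approx
      by (intro card_pairs_gcd_le[where t = t and k = k and b = b and \<gamma> = \<gamma>] T Q S finS X hyp)
         (auto simp: Pt_def)
  qed
  have "?P \<subseteq> P0 \<union> (\<Union>t\<in>{t\<in>GI. gdvd t r}. Pt t)"
  proof clarify
    fix q a assume qa: "(q, a) \<in> ?P" "(q, a) \<notin> (\<Union>t\<in>{t\<in>GI. gdvd t r}. Pt t)"
    hence q: "q \<in> GI" "a \<in> GI" using S by (auto simp: near_pairs_def)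
    define c where "c = a * r - b * q"
    have "c = 0"
    proof (rule ccontr)
      assume c0: "c \<noteq> 0"
      have c: "c \<in> GI" using q r b by (simp add: c_def)
      obtain t x y where t: "t \<in> GI" "t \<noteq> 0" "x \<in> GI" "y \<in> GI" "t = c * x + r * y" "gdvd t c" "gdvd t r"
        using GI_bezout[OF c r(1) disjI1[OF c0]] by blast
      obtain m k where m: "m \<in> GI" "c = t * m" and k: "k \<in> GI" "r = t * k"
        using t(6,7) unfolding gdvd_def by blast
      have "t * (m * x + k * y) = t * 1" using t(5) m k by (simp add: algebra_simps)
      hence "m * x + k * y = 1" using t(2) by (simp only: mult_cancel_left) simp
      hence "gcoprime m k" using gcoprimeI_bezout t by blast
      \<comment> \<open>\<open>t\<close> divides \<open>b * q\<close> and \<open>r\<close>; because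
        \<open>b\<close> is coprime to \<open>r\<close>, it must divide \<open>q\<close>.\<close>
      have "b * q = a * r + - c" by (simp add: c_def)
      hence tbq: "gdvd t (b * q)" using gdvd_add[OF gdvd_mult2[OF t(7)] gdvd_uminus[OF t(6)]] q by simp
      obtain x' y' where xy: "x' \<in> GI" "y' \<in> GI" "b * x' + r * y' = 1"
        using gcoprime_bezout[OF b(2,1) r(1)] by blast
      have "q = (b * x' + r * y') * q" using xy by simp
      also have "\<dots> = b * q * x' + r * (y' * q)" by (simp add: algebra_simps)
      finally have "gdvd t q" using gdvd_add[OF gdvd_mult[OF tbq xy(1)] gdvd_mult[OF t(7), of "y' * q"]] xy(2) q
        by (metis GI_mult)
      then obtain q' where "q' \<in> GI" "q = t * q'" by (auto simp: gdvd_def)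
      moreover have "m \<noteq> 0" using c0 m by auto
      ultimately have "(q, a) \<in> Pt t" using qa(1) k m \<open>gcoprime m k\<close> unfolding Pt_def c_def by blast
      thus False using qa(2) t by blast
    qed
    thus "(q, a) \<in> P0" using qa by (auto simp: P0_def c_def)
  qed
  hence "card ?P \<le> card (P0 \<union> (\<Union>t\<in>{t\<in>GI. gdvd t r}. Pt t))"
    by (rule card_mono[rotated]) (auto intro!: finite_subset[OF _ finP] gdivs_finite r simp: P0_def Pt_def)
  also have "\<dots> \<le> card P0 + card (\<Union>t\<in>{t\<in>GI. gdvd t r}. Pt t)" by (rule card_Un_le)
  also have "\<dots> \<le> 4 + (\<Sum>t\<in>{t\<in>GI. gdvd t r}. card (Pt t))"
    by (intro add_mono card_UN_le gdivs_finite r \<open>card P0 \<le> 4\<close>)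
  finally have "real (card ?P) \<le> real (4 + (\<Sum>t\<in>{t\<in>GI. gdvd t r}. card (Pt t)))" by (rule of_nat_mono)
  also have "\<dots> = 4 + (\<Sum>t\<in>{t\<in>GI. gdvd t r}. real (card (Pt t)))" by simp
  also have "\<dots> \<le> 4 + (\<Sum>t\<in>{t\<in>GI. gdvd t r}. ?B)" by (intro add_mono order_refl sum_mono Pt)
  also have "\<dots> = 4 + real (card {t\<in>GI. gdvd t r}) * ?B" by simp
  also have "\<dots> \<le> 4 + D * ?B"
    using X T by (intro add_mono order_refl mult_right_mono D r) auto
  finally show ?thesis .
qed

section \<open>The main theorem\<close>

text \<open>Subtracting a suitable multiple of \<open>q\<close> moves each residue into the disc of
  radius \<open>cmod q\<close>; incongruent residues stay distinct.\<close>

lemma reduced_residue_system_finite: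
  assumes "q \<in> GI" "q \<noteq> 0" "reduced_residue_system q R"
  shows "finite R"
proof -
  have "\<exists>g\<in>GI. cmod (a / q - g) \<le> 1" for a
  proof -
    obtain g where g: "g \<in> GI" "(cmod (a / q - g))\<^sup>2 \<le> 1 / 2" using GI_round by blast
    hence "(cmod (a / q - g))\<^sup>2 \<le> 1\<^sup>2" by simp
    thus ?thesis using g(1) power2_le_imp_le[of _ 1] by auto
  qed
  then obtain g where g: "\<And>a. g a \<in> GI" "\<And>a. cmod (a / q - g a) \<le> 1" by metis
  have "inj_on (\<lambda>a. a - q * g a) R"
  proof (rule inj_onI)
    fix a b assume *: "a \<in> R" "b \<in> R" "a - q * g a = b - q * g b"
    hence "a - b = q * (g a - g b)" by (simp add: algebra_simps)
    hence "gcong a b q" unfolding gcong_def by (simp add: g)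
    thus "a = b" using * assms(3) by (auto simp: reduced_residue_system_def)
  qed
  moreover have "(\<lambda>a. a - q * g a) ` R \<subseteq> {m\<in>GI. cmod m \<le> cmod q}"
  proof clarify
    fix a assume "a \<in> R"
    hence a: "a \<in> GI" using assms(3) by (auto simp: reduced_residue_system_def)
    have "a - q * g a = q * (a / q - g a)" using assms(2) by (simp add: field_simps)
    hence "cmod (a - q * g a) \<le> cmod q" using g(2)[of a] by (simp add: norm_mult mult_left_le)
    moreover have "a - q * g a \<in> GI" using a assms(1) g(1) by simp
    ultimately show "a - q * g a \<in> GI \<and> cmod (a - q * g a) \<le> cmod q" by blast
  qed
  ultimately show ?thesis using GI_disc(1) finite_subset finite_imageD by metis
qed

text \<open>Passage from torus to plane: the translation by \<open>g\<close> is absorbed into the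
  numerator as a multiple of \<open>q\<close>, which preserves coprimality and merges no two
  residues.\<close>

lemma card_near_residues_le:
  assumes S: "finite S" "S \<subseteq> GI - {0}"
    and R: "\<And>q. q \<in> S \<Longrightarrow> reduced_residue_system q (R q)"
  shows "card {p\<in>Sigma S R. \<exists>g\<in>GI. cmod (snd p / fst p - \<gamma> - g) \<le> d} \<le> card (near_pairs S d \<gamma>)"
proof -
  let ?A = "{p\<in>Sigma S R. \<exists>g\<in>GI. cmod (snd p / fst p - \<gamma> - g) \<le> d}"
  have ex: "\<forall>p\<in>?A. \<exists>g. g \<in> GI \<and> cmod (snd p / fst p - \<gamma> - g) \<le> d" by blast
  obtain h where "\<forall>p\<in>?A. h p \<in> GI \<and> cmod (snd p / fst p - \<gamma> - h p) \<le> d"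
    using bchoice[OF ex] ..
  hence h: "h p \<in> GI \<and> cmod (snd p / fst p - \<gamma> - h p) \<le> d" if "p \<in> ?A" for p
    using that by (rule bspec)
  let ?f = "\<lambda>p. (fst p, snd p - fst p * h p)"
  show ?thesis
  proof (rule card_inj_on_le)
    show "inj_on ?f ?A"
    proof (rule inj_onI)
      fix p p' assume *: "p \<in> ?A" "p' \<in> ?A" "?f p = ?f p'"
      define q where "q = fst p"
      have q: "fst p' = q" "snd p - q * h p = snd p' - q * h p'" using *(3) by (auto simp: q_def)
      hence "snd p - snd p' = q * (h p - h p')" by (simp add: algebra_simps)
      hence "gcong (snd p) (snd p') q" unfolding gcong_def using h[OF *(1)] h[OF *(2)] by simp
      moreover have "q \<in> S" "snd p \<in> R q" "snd p' \<in> R q" using * q(1) by (auto simp: q_def)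
      ultimately have "snd p = snd p'" using R by (auto simp: reduced_residue_system_def)
      thus "p = p'" using q(1) by (simp add: prod_eq_iff q_def)
    qed
    show "?f ` ?A \<subseteq> near_pairs S d \<gamma>"
    proof (rule image_subsetI)
      fix p assume p: "p \<in> ?A"
      obtain q b where qb: "p = (q, b)" by fastforce
      have q: "q \<in> S" "q \<in> GI" "q \<noteq> 0" "b \<in> R q" using p S qb by auto
      hence b: "b \<in> GI" "gcoprime b q" using R[OF q(1)] q(4) by (auto simp: reduced_residue_system_def)
      note hp = h[OF p, unfolded qb, simplified]
      obtain x y where xy: "x \<in> GI" "y \<in> GI" "b * x + q * y = 1"
        using gcoprime_bezout[OF b(2,1) q(2)] by blast
      have "(b - q * h (q, b)) * x + q * (y + h (q, b) * x) = 1"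
        using xy(3) by (simp add: algebra_simps)
      hence "gcoprime (b - q * h (q, b)) q" by (rule gcoprimeI_bezout) (use xy hp in auto)
      moreover have "(b - q * h (q, b)) / q - \<gamma> = b / q - \<gamma> - h (q, b)"
        using q by (simp add: diff_divide_distrib)
      hence "cmod ((b - q * h (q, b)) / q - \<gamma>) \<le> d" using hp by (simp only:)
      ultimately show "?f p \<in> near_pairs S d \<gamma>"
        using q b hp unfolding near_pairs_def qb by simp
    qed
    show "finite (near_pairs S d \<gamma>)" using near_pairs_finite S by blast
  qed
qed

theorem theorem2:
  fixes \<epsilon> :: real
  assumes "\<epsilon> > 0"
  shows "\<exists>c2>0. \<forall>(Q::nat) (N::nat) (a::complex \<Rightarrow> complex) (S::complex set) (X::real)
           (R::complex \<Rightarrow> complex set).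
     Q \<ge> 1 \<longrightarrow> N \<ge> 1 \<longrightarrow>
     S \<subseteq> GI - {0} \<longrightarrow> (\<forall>q\<in>S. cmod q \<le> sqrt (real Q)) \<longrightarrow> X \<ge> 1 \<longrightarrow>
     (\<forall>t\<in>GI - {0}. cmod t \<le> real N powr (1/4) \<longrightarrow>
        (\<forall>k\<in>GI - {0}. cmod k \<le> real N powr (1/4) / cmod t \<longrightarrow>
          (\<forall>l\<in>GI. gcoprime k l \<longrightarrow>
            (\<forall>u::real. cmod k * sqrt (real Q) / (2 * real N powr (1/4)) \<le> u \<and>
                        u \<le> sqrt (real Q) / cmod t \<longrightarrow>
               A_t S Q t u k l
                 \<le> (1 + (real (card (S_t S t)) / gnorm k) / (real Q / (cmod t)\<^sup>2) * u\<^sup>2) * X)))) \<longrightarrow>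
     (\<forall>q\<in>S. reduced_residue_system q (R q)) \<longrightarrow>
     (\<Sum>q\<in>S. \<Sum>b\<in>R q.
        (cmod (\<Sum>n\<in>{n\<in>GI. gnorm n \<le> real N}. a n * ee (Re (n * b / q))))\<^sup>2)
     \<le> c2 * (real N + real Q * X * real N powr \<epsilon> * (sqrt (real N) + real (card S)))
          * (\<Sum>n\<in>{n\<in>GI. gnorm n \<le> real N}. (cmod (a n))\<^sup>2)"
proof -
  \<comment> \<open>The exponent is \<open>4 * \<epsilon>\<close> because the divisor bound is
    applied to \<open>r\<close> with \<open>cmod r \<le> N powr (1 / 4)\<close>.\<close>
  obtain C where C: "C > 0"
    "\<And>r. r \<in> GI \<Longrightarrow> r \<noteq> 0 \<Longrightarrow> real (card {t\<in>GI. gdvd t r}) \<le> C * cmod r powr (4 * \<epsilon>)"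
    using card_gdivs_le[of "4 * \<epsilon>"] assms by auto
  define c2 where "c2 = 16384 * (4 + 729 * C)"
  show ?thesis
  proof (intro exI[of _ c2] conjI allI impI)
    show "c2 > 0" using C by (simp add: c2_def)
  next
    fix Q N :: nat and a :: "complex \<Rightarrow> complex" and S :: "complex set" and X :: real
      and R :: "complex \<Rightarrow> complex set"
    assume Q: "Q \<ge> 1" and N: "N \<ge> 1" and S: "S \<subseteq> GI - {0}" and S_le: "\<forall>q\<in>S. cmod q \<le> sqrt (real Q)"
      and X: "X \<ge> 1"
      and hyp: "\<forall>t\<in>GI - {0}. cmod t \<le> real N powr (1/4) \<longrightarrow>
        (\<forall>k\<in>GI - {0}. cmod k \<le> real N powr (1/4) / cmod t \<longrightarrow>
          (\<forall>l\<in>GI. gcoprime k l \<longrightarrow>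
            (\<forall>u::real. cmod k * sqrt (real Q) / (2 * real N powr (1/4)) \<le> u \<and>
                        u \<le> sqrt (real Q) / cmod t \<longrightarrow>
               A_t S Q t u k l
                 \<le> (1 + (real (card (S_t S t)) / gnorm k) / (real Q / (cmod t)\<^sup>2) * u\<^sup>2) * X)))"
      and R: "\<forall>q\<in>S. reduced_residue_system q (R q)"
    let ?Z = "\<Sum>n\<in>{n\<in>GI. gnorm n \<le> real N}. (cmod (a n))\<^sup>2"
    define T where "T = real N powr (1/4)"
    define K where "K = 4 + C * real N powr \<epsilon> * (729 * real Q * X * (1 / sqrt (real N) + real (card S) / real N))"
    have T1: "1 \<le> T" unfolding T_def using N by (intro ge_one_powr_ge_zero) auto
    have T2: "T\<^sup>2 = sqrt (real N)" using N by (simp add: T_def powr_power powr_half_sqrt)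
    have "T ^ 4 = (T\<^sup>2)\<^sup>2" by (simp flip: power_mult)
    hence T4: "T ^ 4 = real N" by (simp add: T2)
    have finS: "finite S"
      by (rule finite_subset[OF _ GI_disc(1)[of "sqrt (real Q)"]]) (use S S_le in auto)
    have D: "real (card {t\<in>GI. gdvd t r}) \<le> C * real N powr \<epsilon>"
      if "r \<in> GI" "r \<noteq> 0" "cmod r \<le> T" for r
    proof -
      have "cmod r powr (4 * \<epsilon>) \<le> T powr (4 * \<epsilon>)" using that assms by (intro powr_mono2) auto
      also have "\<dots> = real N powr \<epsilon>" by (simp add: T_def powr_powr)
      finally have "C * cmod r powr (4 * \<epsilon>) \<le> C * real N powr \<epsilon>" using C by simp
      thus ?thesis using C(2)[OF that(1,2)] by linarith
    qed
    have near: "real (card (near_pairs S (1 / sqrt (real N)) \<gamma>)) \<le> K" for \<gamma>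
    proof -
      have "real (card (near_pairs S (1 / T\<^sup>2) \<gamma>))
          \<le> 4 + C * real N powr \<epsilon> * (729 * real Q * X * (1 / T\<^sup>2 + real (card S) / T ^ 4))"
        by (rule card_near_pairs_le[OF T1 Q S]) (use S_le X hyp D in \<open>auto simp: T_def\<close>)
      thus ?thesis by (simp add: K_def T2 T4)
    qed
    have "(\<Sum>q\<in>S. \<Sum>b\<in>R q. (cmod (\<Sum>n\<in>{n\<in>GI. gnorm n \<le> real N}. a n * ee (Re (n * b / q))))\<^sup>2)
      = (\<Sum>p\<in>Sigma S R. (cmod (\<Sum>n\<in>{n\<in>GI. gnorm n \<le> real N}. a n * ee (Re (n * (snd p / fst p)))))\<^sup>2)"
      using finS R S reduced_residue_system_finite by (subst sum.Sigma) (auto simp: split_def)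
    also have "\<dots> \<le> 16384 * K * real N * ?Z"
    proof (rule large_sieve)
      show "finite (Sigma S R)" using finS R S reduced_residue_system_finite by (intro finite_SigmaI) auto
      show "real (card {p\<in>Sigma S R. \<exists>g\<in>GI. cmod (snd p / fst p - \<gamma> - g) \<le> 1 / sqrt (real N)}) \<le> K" for \<gamma>
        using card_near_residues_le[OF finS S, of R \<gamma> "1 / sqrt (real N)"] R near[of \<gamma>] by force
    qed (use N in auto)
    also have "16384 * K * real N * ?Z \<le> c2 * (real N + real Q * X * real N powr \<epsilon> * (sqrt (real N) + real (card S))) * ?Z"
    proof (rule mult_right_mono)
      \<comment> \<open>Multiplying \<open>K\<close> by \<open>N\<close> turns its 4 into the
        summand \<open>N\<close>, and \<open>1 / sqrt N + card S / N\<close> into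
        \<open>sqrt N + card S\<close>.\<close>
      let ?W = "real Q * X * real N powr \<epsilon> * (sqrt (real N) + real (card S))"
      have "real N * (1 / sqrt (real N) + real (card S) / real N) = sqrt (real N) + real (card S)"
        using N by (simp add: distrib_left real_div_sqrt)
      moreover have "K * real N = 4 * real N
          + 729 * C * (real Q * X * real N powr \<epsilon> * (real N * (1 / sqrt (real N) + real (card S) / real N)))"
        unfolding K_def by (simp only: algebra_simps)
      ultimately have "K * real N = 4 * real N + 729 * C * ?W" by simp
      also have "\<dots> \<le> (4 + 729 * C) * (real N + ?W)"
        using C X by (simp add: algebra_simps)
      finally have "16384 * (K * real N) \<le> 16384 * ((4 + 729 * C) * (real N + ?W))" by simp
      thus "16384 * K * real N \<le> c2 * (real N + ?W)" by (simp only: c2_def mult.assoc)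
    qed (intro sum_nonneg, auto)
    finally show "(\<Sum>q\<in>S. \<Sum>b\<in>R q. (cmod (\<Sum>n\<in>{n\<in>GI. gnorm n \<le> real N}. a n * ee (Re (n * b / q))))\<^sup>2)
      \<le> c2 * (real N + real Q * X * real N powr \<epsilon> * (sqrt (real N) + real (card S))) * ?Z" .
  qed
qed

end
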